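(* Let $A$ be an $s\times n$ matrix with entries in $\mathbb N\cup\{-\infty\}$, and consider the recursive algorithm $\bar O$-test applied to $A$. (i) This algorithm tests if $\hat{\mathcal O}_A=0$ and, if yes, returns $Y$ such that $\hat{\mathcal O}_A=\mathcal O_{Y,A}$. (ii) It works in $O(d^{1/2}psn)$ elementary operations, where $d$ is the maximal number of transversal $0$ in the matrices $B$ built at each call of the subroutine HK and $p$ is the number of recursive calls of the main algorithm $\bar O$-test. (iii) If at each step $C_0=\emptyset$, then the algorithm works in $O((d^{1/2}+\ln(s))sn)$ operations, using balanced trees.
   Context: For an $s\times n$ matrix $A=(a_{i,j})$ with entries in $\mathbb N\cup\{-\infty\}$ and a set $Y$ of $s$ columns, $\mathcal O_{Y,A}=\max_\sigma\sum_{i=1}^sa_{i,\sigma(i)}$ over bijections $\sigma:\{1,\dots,s\}\to Y$. $\hat{\mathcal O}_A=\min\{\mathcal O_{Y,A}:\sharp Y=s,\ \mathcal O_{Y,A}\neq-\infty\}$, where $\sharp$ denotes the number of elements; by convention $\hat{\mathcal O}_A=-\infty$ if $\mathcal O_{Y,A}=-\infty$ for all $Y$ or if $s>n$. For a matrix $B$ with entries in $\{0,-\infty\}$, entries in mutually different rows and columns are called transversal; let $r$ be the maximal number of transversal entries $0$. There exist a unique set of rows $R_0$, maximal for inclusion, and a unique set of columns $C_0$, minimal for inclusion, such that $\sharp R_0+\sharp C_0=r$ and all entries $0$ belong to rows in $R_0$ or columns in $C_0$. The subroutine HK$(B)$ returns $(R_0,C_0,Y_1)$, where, for a maximal family of $r$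 transversal entries $0$ of $B$ in positions $(i_k,j_k)$, $1\le k\le r$, one sets $Y_1=\{j_k\mid j_k\notin C_0\}$. It is based on the Hopcroft–Karp algorithm and requires $O(r^{1/2}s'n')$ elementary operations for an $s'\times n'$ matrix $B$. If $B$ contains only $-\infty$ entries, $R_0$ and $Y_1$ are $\emptyset$ by convention. Algorithm $\bar O$-test$(A)$. Input: an $s\times n$ matrix $A$ with entries in $\mathbb N\cup\{-\infty\}$. Output: "failed" or a set $Y$ of columns such that $\mathcal O_{Y,A}=0$. Steps: If $s>n$ or some row of $A$ contains no entry equal to $0$, return "failed". Suppress from $A$ all columns of $-\infty$. Build $B$, the submatrix of $A$ of the columns containing only $-\infty$ or $0$ elements. Set $(R_0,C_0,Y_1):=$ HK$(B)$. If $R_0=\emptyset$, return "failed". Set $Y_2:=\bar O$-test$(A\setminus R_0)$, where $A\setminus R_0$ is the matrix $A$ with the rows in $R_0$ suppressed. If $Y_2=$ "failed", return "failed". Return $Y_2\cup Y_1$. Balanced trees: one may sort the elements in the columns of an $s\times n$ matrix and store the results in balanced (AVL) trees with complexity $ns\ln(s)$, which allows one to delete an element in a column with cost $\ln(s)$, preserving the order, and to get the greatest element of a column with cost $\ln(s)$.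
   Formalization: The algorithm is given the missing base case (a matrix with no rows returns the empty set; literally every run would end in "failed"), and in (ii) and (iii) s, n ≥ 1 is assumed and d is replaced by max(1,d), since the literal bounds can vanish. *)

theory Defs
  imports "HOL-Library.Extended_Real" "HOL-Library.Multiset" "HOL-Library.Monad_Syntax"
begin

text \<open>
  A matrix is an entry function together with a collection of row labels and a collection of
  column labels; an s by n matrix has rows 1..s and columns 1..n. Submatrices keep the labels
  (and the entry function) of the matrix they are taken from. Entries are extended reals
  restricted to the natural numbers and minus infinity, so that sums and orderings are those
  of the library.
\<close>

type_synonym entries = "nat \<Rightarrow> nat \<Rightarrow> ereal"

definition nat_minf :: "ereal set" where
  "nat_minf = insert (-\<infinity>) (range (\<lambda>k::nat. ereal (real k)))"

definition entries_in :: "ereal set \<Rightarrow> nat set \<Rightarrow> nat set \<Rightarrow> entries \<Rightarrow> bool" where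
  "entries_in E R C A \<longleftrightarrow> (\<forall>i\<in>R. \<forall>j\<in>C. A i j \<in> E)"

definition O_det :: "nat set \<Rightarrow> nat set \<Rightarrow> entries \<Rightarrow> ereal" where
  "O_det R Y A = Max {(\<Sum>i\<in>R. A i (\<sigma> i)) | \<sigma>. bij_betw \<sigma> R Y}"

definition O_hat :: "nat set \<Rightarrow> nat set \<Rightarrow> entries \<Rightarrow> ereal" where
  "O_hat R C A =
     (let V = {O_det R Y A | Y. Y \<subseteq> C \<and> card Y = card R \<and> O_det R Y A \<noteq> -\<infinity>}
      in if V = {} then -\<infinity> else Min V)"

definition transversal_zeros :: "nat set \<Rightarrow> nat set \<Rightarrow> entries \<Rightarrow> (nat \<times> nat) set \<Rightarrow> bool" where
  "transversal_zeros R C B P \<longleftrightarrow>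
     P \<subseteq> R \<times> C \<and> inj_on fst P \<and> inj_on snd P \<and> (\<forall>(i, j)\<in>P. B i j = 0)"

definition max_transversal :: "nat set \<Rightarrow> nat set \<Rightarrow> entries \<Rightarrow> nat" where
  "max_transversal R C B = Max {card P | P. transversal_zeros R C B P}"

definition zero_cover :: "nat set \<Rightarrow> nat set \<Rightarrow> entries \<Rightarrow> nat set \<Rightarrow> nat set \<Rightarrow> bool" where
  "zero_cover R C B R0 C0 \<longleftrightarrow>
     R0 \<subseteq> R \<and> C0 \<subseteq> C \<and> card R0 + card C0 = max_transversal R C B \<and>
     (\<forall>i\<in>R. \<forall>j\<in>C. B i j = 0 \<longrightarrow> i \<in> R0 \<or> j \<in> C0)"

definition HK_output :: "nat set \<Rightarrow> nat set \<Rightarrow> entries \<Rightarrow> nat set \<times> nat set \<times> nat set \<Rightarrow> bool" where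
  "HK_output R C B = (\<lambda>(R0, C0, Y1).
     zero_cover R C B R0 C0 \<and>
     (\<forall>R' C'. zero_cover R C B R' C' \<longrightarrow> \<not> R0 \<subset> R' \<and> \<not> C' \<subset> C0) \<and>
     (\<exists>P. transversal_zeros R C B P \<and> card P = max_transversal R C B \<and>
          Y1 = {j \<in> snd ` P. j \<notin> C0}))"

text \<open>
  A subroutine is given by its result together with the number of elementary operations it
  performs. Only its behaviour on matrices over 0 and minus infinity is constrained.
\<close>

type_synonym hk_sub =
  "nat list \<Rightarrow> nat list \<Rightarrow> entries \<Rightarrow> (nat set \<times> nat set \<times> nat set) \<times> nat"

definition HK_correct :: "hk_sub \<Rightarrow> bool" where
  "HK_correct hk \<longleftrightarrow>
     (\<forall>R C B. distinct R \<and> distinct C \<and> entries_in {0, -\<infinity>} (set R) (set C) B \<longrightarrow>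
        HK_output (set R) (set C) B (fst (hk R C B)))"

text \<open>
  The operation count r^(1/2) s' n' is to be read up to the constant cost of a call and,
  when r = 0, up to the cost of inspecting the entries: hence the summand 1 and the maximum.
\<close>

definition HK_complexity :: "real \<Rightarrow> hk_sub \<Rightarrow> bool" where
  "HK_complexity K hk \<longleftrightarrow>
     (\<forall>R C B. distinct R \<and> distinct C \<and> entries_in {0, -\<infinity>} (set R) (set C) B \<longrightarrow>
        real (snd (hk R C B)) \<le>
          K * (1 + sqrt (real (max 1 (max_transversal (set R) (set C) B)))
                   * real (length R) * real (length C)))"

text \<open>
  The elements of a column are stored with multiplicity; \<open>rep t M\<close> reads ``the tree t
  stores the multiset M''. Each operation also returns its number of elementary operations.
  The summand 1 accounts for ln 1 = 0.
\<close>

record 't tree_sub =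
  sort_column :: "ereal list \<Rightarrow> 't \<times> nat"
  delete_element :: "ereal \<Rightarrow> 't \<Rightarrow> 't \<times> nat"
  greatest_element :: "'t \<Rightarrow> ereal \<times> nat"

definition balanced_trees :: "real \<Rightarrow> 't tree_sub \<Rightarrow> bool" where
  "balanced_trees K T \<longleftrightarrow> (\<exists>rep :: 't \<Rightarrow> ereal multiset \<Rightarrow> bool.
     (\<forall>xs. rep (fst (sort_column T xs)) (mset xs) \<and>
        (xs \<noteq> [] \<longrightarrow> real (snd (sort_column T xs))
            \<le> K * (real (length xs) * (1 + ln (real (length xs)))))) \<and>
     (\<forall>t M x. rep t M \<and> x \<in># M \<longrightarrow>
        rep (fst (delete_element T x t)) (M - {#x#}) \<and>
        real (snd (delete_element T x t)) \<le> K * (1 + ln (real (size M)))) \<and>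
     (\<forall>t M. rep t M \<and> M \<noteq> {#} \<longrightarrow>
        fst (greatest_element T t) = Max (set_mset M) \<and>
        real (snd (greatest_element T t)) \<le> K * (1 + ln (real (size M)))))"

text \<open>
  A run is a result together with the list of the events that occurred: elementary operations
  (several may be recorded at once), calls of the main algorithm, and calls of HK with
  argument, result and number of elementary operations.
\<close>

datatype event =
    Ops nat
  | Main_Call
  | HK_Call "nat list" "nat list" entries "nat set \<times> nat set \<times> nat set" nat

type_synonym 'a run = "'a \<times> event list"

definition return :: "'a \<Rightarrow> 'a run" where
  "return x = (x, [])"

definition bind_run :: "'a run \<Rightarrow> ('a \<Rightarrow> 'b run) \<Rightarrow> 'b run" where
  "bind_run m f = (fst (f (fst m)), snd m @ snd (f (fst m)))"

adhoc_overloading Monad_Syntax.bind \<rightleftharpoons> bind_run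

lemma bind_run_cong [fundef_cong]:
  "m = m' \<Longrightarrow> (\<And>x. x = fst m' \<Longrightarrow> f x = f' x) \<Longrightarrow> bind_run m f = bind_run m' f'"
  by (simp add: bind_run_def)

definition tick :: "nat \<Rightarrow> unit run" where
  "tick k = ((), [Ops k])"

definition enter :: "unit run" where
  "enter = ((), [Main_Call])"

definition run_sub :: "'a \<times> nat \<Rightarrow> 'a run" where
  "run_sub x = (fst x, [Ops (snd x)])"

definition run_HK :: "hk_sub \<Rightarrow> nat list \<Rightarrow> nat list \<Rightarrow> entries \<Rightarrow> (nat set \<times> nat set \<times> nat set) run" where
  "run_HK hk R C B = (fst (hk R C B), [HK_Call R C B (fst (hk R C B)) (snd (hk R C B))])"

fun event_cost :: "event \<Rightarrow> nat" where
  "event_cost (Ops k) = k"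
| "event_cost Main_Call = 1"
| "event_cost (HK_Call R C B out k) = k"

fun is_HK_Call :: "event \<Rightarrow> bool" where
  "is_HK_Call (HK_Call R C B out k) = True"
| "is_HK_Call _ = False"

fun HK_rank :: "event \<Rightarrow> nat" where
  "HK_rank (HK_Call R C B out k) = max_transversal (set R) (set C) B"
| "HK_rank _ = 0"

definition result :: "'a run \<Rightarrow> 'a" where
  "result = fst"

definition operations :: "'a run \<Rightarrow> nat" where
  "operations m = sum_list (map event_cost (snd m))"

text \<open>
  The initial call is counted by \<open>main_calls\<close>, and \<open>max_HK_rank\<close> is 0 if HK is never called.
\<close>

definition main_calls :: "'a run \<Rightarrow> nat" where
  "main_calls m = length (filter (\<lambda>e. e = Main_Call) (snd m))"

definition HK_calls :: "'a run \<Rightarrow> event list" where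
  "HK_calls m = filter is_HK_Call (snd m)"

definition max_HK_rank :: "'a run \<Rightarrow> nat" where
  "max_HK_rank m = Max (insert 0 (HK_rank ` set (HK_calls m)))"

definition all_C0_empty :: "'a run \<Rightarrow> bool" where
  "all_C0_empty m \<longleftrightarrow> (\<forall>R C B R0 C0 Y1 k. HK_Call R C B (R0, C0, Y1) k \<in> set (snd m) \<longrightarrow> C0 = {})"

fun filter_run :: "('a \<Rightarrow> bool run) \<Rightarrow> 'a list \<Rightarrow> 'a list run" where
  "filter_run p [] = return []"
| "filter_run p (x # xs) = do {
     tick 1;
     b \<leftarrow> p x;
     ys \<leftarrow> filter_run p xs;
     return (if b then x # ys else ys)
   }"

fun exists_run :: "('a \<Rightarrow> bool run) \<Rightarrow> 'a list \<Rightarrow> bool run" where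
  "exists_run p [] = return False"
| "exists_run p (x # xs) = do {
     tick 1;
     b \<leftarrow> p x;
     if b then return True else exists_run p xs
   }"

definition read :: "entries \<Rightarrow> nat \<Rightarrow> nat \<Rightarrow> ereal run" where
  "read A i j = do { tick 1; return (A i j) }"

definition member_run :: "nat set \<Rightarrow> nat \<Rightarrow> bool run" where
  "member_run S i = do { tick 1; return (i \<in> S) }"

lemma fst_filter_run: "fst (filter_run p xs) = filter (\<lambda>x. fst (p x)) xs"
  by (induction xs) (simp_all add: bind_run_def return_def)

definition row_has_zero :: "entries \<Rightarrow> nat list \<Rightarrow> nat \<Rightarrow> bool run" where
  "row_has_zero A C i = exists_run (\<lambda>j. do { x \<leftarrow> read A i j; return (x = 0) }) C"

definition some_row_without_zero :: "entries \<Rightarrow> nat list \<Rightarrow> nat list \<Rightarrow> bool run" where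
  "some_row_without_zero A R C = exists_run (\<lambda>i. do { b \<leftarrow> row_has_zero A C i; return (\<not> b) }) R"

definition col_not_minf :: "entries \<Rightarrow> nat list \<Rightarrow> nat \<Rightarrow> bool run" where
  "col_not_minf A R j = exists_run (\<lambda>i. do { x \<leftarrow> read A i j; return (x \<noteq> -\<infinity>) }) R"

definition col_only_zero_minf :: "entries \<Rightarrow> nat list \<Rightarrow> nat \<Rightarrow> bool run" where
  "col_only_zero_minf A R j = do {
     b \<leftarrow> exists_run (\<lambda>i. do { x \<leftarrow> read A i j; return (x \<noteq> 0 \<and> x \<noteq> -\<infinity>) }) R;
     return (\<not> b)
   }"

text \<open>
  Submatrices share the entry function of the original; copying the entries is charged
  by \<open>copy_submatrix\<close>.
\<close>

definition copy_submatrix :: "nat list \<Rightarrow> nat list \<Rightarrow> unit run" where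
  "copy_submatrix R C = tick (length R * length C)"

text \<open>
  The result \<open>None\<close> stands for ``failed''. The recursion ends when all rows have been
  suppressed: the empty set of columns is then returned, the empty sum being 0. For outputs of
  HK one has R0 contained in R, so that \<open>R0_list\<close> is empty iff R0 is.
\<close>

function (sequential) O_test :: "hk_sub \<Rightarrow> entries \<Rightarrow> nat list \<Rightarrow> nat list \<Rightarrow> nat set option run" where
  "O_test hk A R C = do {
     enter;
     tick (length R + length C);
     if length R > length C then return None
     else if R = [] then return (Some {})
     else do {
       bad \<leftarrow> some_row_without_zero A R C;
       if bad then return None
       else do {
         C' \<leftarrow> filter_run (col_not_minf A R) C;
         C_B \<leftarrow> filter_run (col_only_zero_minf A R) C';
         copy_submatrix R C_B;
         (R0, C0, Y1) \<leftarrow> run_HK hk R C_B A;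
         R0_list \<leftarrow> filter_run (member_run R0) R;
         if R0_list = [] then return None
         else do {
           R' \<leftarrow> filter_run (\<lambda>i. do { b \<leftarrow> member_run R0 i; return (\<not> b) }) R;
           copy_submatrix R' C';
           res \<leftarrow> O_test hk A R' C';
           case res of
             None \<Rightarrow> return None
           | Some Y2 \<Rightarrow> do { tick (1 + card Y1); return (Some (Y2 \<union> Y1)) }
         }
       }
     }
   }"
  by pat_completeness auto
termination
  by (relation "Wellfounded.measure (\<lambda>(hk, A, R, C). length R)")
    (auto simp: fst_filter_run bind_run_def member_run_def return_def tick_def filter_empty_conv
       intro!: length_filter_less)

declare O_test.simps [simp del]

fun sort_columns :: "'t tree_sub \<Rightarrow> entries \<Rightarrow> nat list \<Rightarrow> nat list \<Rightarrow> (nat \<Rightarrow> 't) run" where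
  "sort_columns T A R [] = return (\<lambda>_. undefined)"
| "sort_columns T A R (j # C) = do {
     f \<leftarrow> sort_columns T A R C;
     tick (1 + length R);
     t \<leftarrow> run_sub (sort_column T (map (\<lambda>i. A i j) R));
     return (f(j := t))
   }"

fun delete_row :: "'t tree_sub \<Rightarrow> entries \<Rightarrow> nat \<Rightarrow> nat list \<Rightarrow> (nat \<Rightarrow> 't) \<Rightarrow> (nat \<Rightarrow> 't) run" where
  "delete_row T A i [] f = return f"
| "delete_row T A i (j # C) f = do {
     x \<leftarrow> read A i j;
     t \<leftarrow> run_sub (delete_element T x (f j));
     delete_row T A i C (f(j := t))
   }"

fun delete_rows :: "'t tree_sub \<Rightarrow> entries \<Rightarrow> nat list \<Rightarrow> nat list \<Rightarrow> (nat \<Rightarrow> 't) \<Rightarrow> (nat \<Rightarrow> 't) run" where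
  "delete_rows T A [] C f = return f"
| "delete_rows T A (i # R) C f = do {
     tick 1;
     f' \<leftarrow> delete_row T A i C f;
     delete_rows T A R C f'
   }"

text \<open>
  Only columns of minus infinity and whole rows are ever suppressed, so a remaining row
  contains a zero iff it did in the initial matrix: \<open>Z\<close> is the list of the rows containing
  a zero, computed once and consulted, as a table, at unit cost.
\<close>

function (sequential) O_test_trees_rec ::
  "hk_sub \<Rightarrow> 't tree_sub \<Rightarrow> entries \<Rightarrow> nat list \<Rightarrow> nat list \<Rightarrow> nat list \<Rightarrow> (nat \<Rightarrow> 't)
     \<Rightarrow> nat set option run" where
  "O_test_trees_rec hk T A Z R C f = do {
     enter;
     tick (length R + length C);
     if length R > length C then return None
     else if R = [] then return (Some {})
     else do {
       bad \<leftarrow> exists_run (\<lambda>i. do { b \<leftarrow> member_run (set Z) i; return (\<not> b) }) R;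
       if bad then return None
       else do {
         C' \<leftarrow> filter_run (\<lambda>j. do { m \<leftarrow> run_sub (greatest_element T (f j)); return (m \<noteq> -\<infinity>) }) C;
         C_B \<leftarrow> filter_run (\<lambda>j. do { m \<leftarrow> run_sub (greatest_element T (f j)); return (m \<le> 0) }) C';
         copy_submatrix R C_B;
         (R0, C0, Y1) \<leftarrow> run_HK hk R C_B A;
         R0_list \<leftarrow> filter_run (member_run R0) R;
         if R0_list = [] then return None
         else do {
           R' \<leftarrow> filter_run (\<lambda>i. do { b \<leftarrow> member_run R0 i; return (\<not> b) }) R;
           f' \<leftarrow> delete_rows T A R0_list C' f;
           res \<leftarrow> O_test_trees_rec hk T A Z R' C' f';
           case res of
             None \<Rightarrow> return None
           | Some Y2 \<Rightarrow> do { tick (1 + card Y1); return (Some (Y2 \<union> Y1)) }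
         }
       }
     }
   }"
  by pat_completeness auto
termination
  by (relation "Wellfounded.measure (\<lambda>(hk, T, A, Z, R, C, f). length R)")
    (auto simp: fst_filter_run bind_run_def member_run_def return_def tick_def filter_empty_conv
       intro!: length_filter_less)

declare O_test_trees_rec.simps [simp del]

definition O_test_trees ::
  "hk_sub \<Rightarrow> 't tree_sub \<Rightarrow> entries \<Rightarrow> nat list \<Rightarrow> nat list \<Rightarrow> nat set option run" where
  "O_test_trees hk T A R C = do {
     Z \<leftarrow> filter_run (row_has_zero A C) R;
     f \<leftarrow> sort_columns T A R C;
     O_test_trees_rec hk T A Z R C f
   }"

end

theory Submission
  imports Defs "HOL-Combinatorics.Cycles" "HOL-Library.Transitive_Closure_Table"
begin

text \<open>
  For entries in \<open>\<nat> \<union> {-\<infinity>}\<close> the determinant of the columns \<open>Y\<close> is 0 iff some bijection onto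
  \<open>Y\<close> meets only zeros and every bijection that avoids \<open>-\<infinity>\<close> meets only zeros
  (\<open>vanishing_det\<close>, \<open>O_det_eq_0_iff\<close>). Determinants other than \<open>-\<infinity>\<close> are nonnegative, so the
  minimum over \<open>Y\<close> is 0 iff some \<open>Y\<close> has this property (\<open>O_hat_eq_0_iff\<close>).

  A call that succeeds returns such a \<open>Y\<close> (\<open>recursion_sound\<close>). By the counting behind Koenig's
  theorem, the columns \<open>Y1\<close> are matched with the rows \<open>R0\<close> by zeros, and they contain only \<open>-\<infinity>\<close>
  in the other rows. Hence a bijection onto \<open>Y2 \<union> Y1\<close> that avoids \<open>-\<infinity>\<close> must send \<open>R0\<close> onto
  \<open>Y1\<close>, where it meets zeros, and the other rows onto \<open>Y2\<close>, where the recursive call applies.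

  Conversely let \<open>\<sigma>\<close> be a bijection onto \<open>Y\<close> that meets only zeros, all of whose competitors
  avoiding \<open>-\<infinity>\<close> do so too. The restriction of \<open>\<sigma>\<close> to the rows outside \<open>R0\<close> has the same
  property, whatever \<open>R0\<close> is, so the only danger is that \<open>R0\<close> is empty
  (\<open>recursion_complete\<close>). Draw an arrow from row \<open>x\<close> to row \<open>y\<close> if the entry of \<open>x\<close> in
  column \<open>\<sigma> y\<close> is not \<open>-\<infinity>\<close>. Entries along cycles are 0, as \<open>\<sigma>\<close> can be rerouted along a cycle.
  An initial strongly connected component \<open>M\<close> is thus a block whose columns \<open>\<sigma> ` M\<close> contain only
  0 and \<open>-\<infinity>\<close>, with all zeros in the rows \<open>M\<close> (\<open>vanishing_det_closed_block\<close>). In a minimal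
  cover of the zeros the columns of the block can be exchanged for its rows, so a cover with the
  largest set of rows contains \<open>M\<close> (\<open>maximal_cover_contains_closed_block\<close>).

  For the first complexity bound, each call of the main algorithm inspects every entry a bounded
  number of times and runs the subroutine once. In the variant with sorted columns a call costs
  at most two tree accesses per column plus the subroutine, and every suppressed row costs one
  further access per column; since at most \<open>s\<close> rows are suppressed, the trees cost \<open>O(s n (1 + ln s))\<close>
  altogether. If the covers use no column, all zeros of the columns given to the subroutine lie in
  suppressed rows, so these columns become columns of \<open>-\<infinity>\<close> and are dropped by the next call
  (\<open>zero_cols_vanish\<close>). Each column is therefore given to the subroutine at most once, and all
  runs of the subroutine together cost \<open>O(d\<^sup>1\<^sup>/\<^sup>2 s n)\<close> up to one constant per call.
\<close>

section \<open>Vanishing tropical determinants\<close>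

text \<open>
  A sum of elements of \<open>\<nat> \<union> {-\<infinity>}\<close> is \<open>-\<infinity>\<close> as soon as one term is, and otherwise it is 0 only
  if all terms are. So a maximal sum equal to 0 can be expressed by conditions on single entries,
  which survive deletion of rows and columns more easily than conditions on sums.
\<close>

definition vanishing_det :: "nat set \<Rightarrow> nat set \<Rightarrow> entries \<Rightarrow> bool" where
  "vanishing_det R Y A \<longleftrightarrow>
     (\<exists>\<sigma>. bij_betw \<sigma> R Y \<and> (\<forall>i\<in>R. A i (\<sigma> i) = 0)) \<and>
     (\<forall>\<tau>. bij_betw \<tau> R Y \<longrightarrow> (\<forall>i\<in>R. A i (\<tau> i) \<noteq> -\<infinity>) \<longrightarrow> (\<forall>i\<in>R. A i (\<tau> i) = 0))"

lemma nat_minfD: "x \<in> nat_minf \<Longrightarrow> x = -\<infinity> \<or> 0 \<le> x"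
  by (auto simp: nat_minf_def)

lemma nat_minf_not_PInf: "x \<in> nat_minf \<Longrightarrow> x \<noteq> \<infinity>"
  by (auto simp: nat_minf_def)

lemma sum_nat_minf_eq_MInf:
  fixes a :: "nat \<Rightarrow> ereal"
  assumes "finite R" "\<And>i. i \<in> R \<Longrightarrow> a i \<in> nat_minf" "\<exists>i\<in>R. a i = -\<infinity>"
  shows "(\<Sum>i\<in>R. a i) = -\<infinity>"
proof -
  have "(\<Sum>i\<in>R. a i) \<noteq> \<infinity> \<and> ((\<exists>i\<in>R. a i = -\<infinity>) \<longrightarrow> (\<Sum>i\<in>R. a i) = -\<infinity>)"
    using assms(1,2)
  proof (induction R rule: finite_induct)
    case (insert x F)
    have "a x \<noteq> \<infinity>" using insert.prems by (simp add: nat_minf_not_PInf)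
    with insert show ?case by auto
  qed simp
  with assms(3) show ?thesis by blast
qed

lemma sum_nat_minf_nonneg:
  fixes a :: "nat \<Rightarrow> ereal"
  assumes "\<And>i. i \<in> R \<Longrightarrow> a i \<in> nat_minf" "\<forall>i\<in>R. a i \<noteq> -\<infinity>"
  shows "0 \<le> (\<Sum>i\<in>R. a i)"
proof (rule sum_nonneg)
  fix i assume "i \<in> R"
  with assms show "0 \<le> a i" using nat_minfD by blast
qed

lemma sum_nat_minf_eq_0_iff:
  fixes a :: "nat \<Rightarrow> ereal"
  assumes "finite R" "\<And>i. i \<in> R \<Longrightarrow> a i \<in> nat_minf"
  shows "(\<Sum>i\<in>R. a i) = 0 \<longleftrightarrow> (\<forall>i\<in>R. a i = 0)"
proof (cases "\<exists>i\<in>R. a i = -\<infinity>")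
  case True
  then have "(\<Sum>i\<in>R. a i) = -\<infinity>" using sum_nat_minf_eq_MInf[of R a] assms by blast
  with True show ?thesis by fastforce
next
  case False
  then have "\<And>i. i \<in> R \<Longrightarrow> 0 \<le> a i" using assms(2) nat_minfD by blast
  with assms(1) show ?thesis by (rule sum_nonneg_eq_0_iff)
qed

text \<open>
  The bijections, as functions on all numbers, form an infinite set; their sums depend only on the
  restrictions to \<open>R\<close>. This makes the maximum that defines the determinant meaningful.
\<close>

lemma finite_bij_sums:
  fixes A :: entries
  assumes "finite R" "finite Y"
  shows "finite {(\<Sum>i\<in>R. A i (\<sigma> i)) | \<sigma>. bij_betw \<sigma> R Y}"
proof (rule finite_subset)
  show "{(\<Sum>i\<in>R. A i (\<sigma> i)) | \<sigma>. bij_betw \<sigma> R Y} \<subseteq> (\<lambda>\<sigma>. \<Sum>i\<in>R. A i (\<sigma> i)) ` (PiE R (\<lambda>_. Y))"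
  proof safe
    fix \<sigma> assume b: "bij_betw \<sigma> R Y"
    have "(\<Sum>i\<in>R. A i (\<sigma> i)) = (\<Sum>i\<in>R. A i (restrict \<sigma> R i))"
      by (rule sum.cong) auto
    moreover have "restrict \<sigma> R \<in> PiE R (\<lambda>_. Y)" using b by (auto simp: bij_betw_def)
    ultimately show "(\<Sum>i\<in>R. A i (\<sigma> i)) \<in> (\<lambda>\<sigma>. \<Sum>i\<in>R. A i (\<sigma> i)) ` (PiE R (\<lambda>_. Y))"
      by blast
  qed
  show "finite ((\<lambda>\<sigma>. \<Sum>i\<in>R. A i (\<sigma> i)) ` (PiE R (\<lambda>_. Y)))"
    using assms by (intro finite_imageI finite_PiE) auto
qed

lemma bij_sums_nonempty:
  assumes "finite R" "finite Y" "card Y = card R"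
  shows "{(\<Sum>i\<in>R. (A :: entries) i (\<sigma> i)) | \<sigma>. bij_betw \<sigma> R Y} \<noteq> {}"
  using finite_same_card_bij[OF assms(1,2)] assms(3) by auto

lemma O_det_eq_0_iff:
  assumes fin: "finite R" "finite Y" and card: "card Y = card R" and A: "entries_in nat_minf R Y A"
  shows "O_det R Y A = 0 \<longleftrightarrow> vanishing_det R Y A"
proof -
  have entry: "A i (\<sigma> i) \<in> nat_minf" if "bij_betw \<sigma> R Y" "i \<in> R" for \<sigma> i
    using that A by (auto simp: entries_in_def bij_betw_def)
  have zero: "(\<Sum>i\<in>R. A i (\<sigma> i)) = 0 \<longleftrightarrow> (\<forall>i\<in>R. A i (\<sigma> i) = 0)" if "bij_betw \<sigma> R Y" for \<sigma>
    using sum_nat_minf_eq_0_iff[of R "\<lambda>i. A i (\<sigma> i)"] fin(1) entry[OF that] by blast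
  have nonpos: "(\<Sum>i\<in>R. A i (\<sigma> i)) \<le> 0 \<longleftrightarrow>
      ((\<forall>i\<in>R. A i (\<sigma> i) \<noteq> -\<infinity>) \<longrightarrow> (\<forall>i\<in>R. A i (\<sigma> i) = 0))" if b: "bij_betw \<sigma> R Y" for \<sigma>
  proof (cases "\<exists>i\<in>R. A i (\<sigma> i) = -\<infinity>")
    case True
    then have "(\<Sum>i\<in>R. A i (\<sigma> i)) = -\<infinity>"
      using sum_nat_minf_eq_MInf[of R "\<lambda>i. A i (\<sigma> i)"] fin(1) entry[OF b] by blast
    with True show ?thesis by auto
  next
    case False
    then have "0 \<le> (\<Sum>i\<in>R. A i (\<sigma> i))"
      using sum_nat_minf_nonneg[of R "\<lambda>i. A i (\<sigma> i)"] entry[OF b] by blast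
    with False zero[OF b] show ?thesis by (metis order_antisym order_refl)
  qed
  have "O_det R Y A = 0 \<longleftrightarrow>
      0 \<in> {(\<Sum>i\<in>R. A i (\<sigma> i)) | \<sigma>. bij_betw \<sigma> R Y} \<and>
      (\<forall>x\<in>{(\<Sum>i\<in>R. A i (\<sigma> i)) | \<sigma>. bij_betw \<sigma> R Y}. x \<le> 0)"
    unfolding O_det_def
    by (rule Max_eq_iff[OF finite_bij_sums[OF fin] bij_sums_nonempty[OF fin card]])
  also have "\<dots> \<longleftrightarrow> (\<exists>\<sigma>. bij_betw \<sigma> R Y \<and> (\<Sum>i\<in>R. A i (\<sigma> i)) = 0) \<and>
      (\<forall>\<sigma>. bij_betw \<sigma> R Y \<longrightarrow> (\<Sum>i\<in>R. A i (\<sigma> i)) \<le> 0)"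
    unfolding mem_Collect_eq Ball_def by metis
  also have "\<dots> \<longleftrightarrow> vanishing_det R Y A"
    unfolding vanishing_det_def using zero nonpos by meson
  finally show ?thesis .
qed

text \<open>
  Every finite determinant is nonnegative, so the value 0, once attained, is the minimum.
\<close>

lemma O_det_nonneg:
  assumes fin: "finite R" "finite Y" and card: "card Y = card R" and A: "entries_in nat_minf R Y A"
    and "O_det R Y A \<noteq> -\<infinity>"
  shows "0 \<le> O_det R Y A"
proof -
  have "O_det R Y A \<in> {(\<Sum>i\<in>R. A i (\<sigma> i)) | \<sigma>. bij_betw \<sigma> R Y}"
    unfolding O_det_def by (rule Max_in[OF finite_bij_sums[OF fin] bij_sums_nonempty[OF fin card]])
  then obtain \<sigma> where b: "bij_betw \<sigma> R Y" and eq: "O_det R Y A = (\<Sum>i\<in>R. A i (\<sigma> i))"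
    by blast
  have entry: "\<And>i. i \<in> R \<Longrightarrow> A i (\<sigma> i) \<in> nat_minf"
    using b A by (auto simp: entries_in_def bij_betw_def)
  show ?thesis
    using sum_nat_minf_eq_MInf[of R "\<lambda>i. A i (\<sigma> i)"] sum_nat_minf_nonneg[of R "\<lambda>i. A i (\<sigma> i)"]
      fin(1) entry assms(5) eq by auto
qed

lemma O_hat_eq_0_iff:
  assumes "finite R" "finite C" "entries_in nat_minf R C A"
  shows "O_hat R C A = 0 \<longleftrightarrow> (\<exists>Y\<subseteq>C. card Y = card R \<and> O_det R Y A = 0)"
proof -
  define V where "V = {O_det R Y A | Y. Y \<subseteq> C \<and> card Y = card R \<and> O_det R Y A \<noteq> -\<infinity>}"
  have finV: "finite V"
    unfolding V_def using assms(2)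
    by (auto intro!: finite_surj[of "Pow C" _ "\<lambda>Y. O_det R Y A"])
  have nonneg: "0 \<le> x" if "x \<in> V" for x
  proof -
    from that obtain Y where Y: "Y \<subseteq> C" "card Y = card R" "O_det R Y A \<noteq> -\<infinity>" "x = O_det R Y A"
      by (auto simp: V_def)
    with assms have "finite Y" "entries_in nat_minf R Y A"
      by (auto intro: finite_subset simp: entries_in_def)
    with assms(1) Y show ?thesis using O_det_nonneg by blast
  qed
  have "O_hat R C A = 0 \<longleftrightarrow> 0 \<in> V"
    unfolding O_hat_def V_def[symmetric] Let_def
    using finV nonneg Min_eq_iff[of V 0] by auto
  also have "\<dots> \<longleftrightarrow> (\<exists>Y\<subseteq>C. card Y = card R \<and> O_det R Y A = 0)"
    unfolding V_def mem_Collect_eq by (intro iff_exI) (auto simp: eq_commute[of 0 "O_det R _ A"])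
  finally show ?thesis .
qed

section \<open>Minimal covers of the zeros\<close>

lemma transversal_zerosD:
  assumes "transversal_zeros R C B P"
  shows "P \<subseteq> R \<times> C" "inj_on fst P" "inj_on snd P" "\<And>i j. (i, j) \<in> P \<Longrightarrow> B i j = 0"
  using assms by (auto simp: transversal_zeros_def)

text \<open>
  The easy half of Koenig's theorem: transversal zeros need different lines of a cover.
\<close>

lemma card_transversal_le_cover:
  assumes P: "transversal_zeros R C B P" and fin: "finite R" "finite C"
    and sub: "R' \<subseteq> R" "C' \<subseteq> C" and cover: "\<forall>i\<in>R. \<forall>j\<in>C. B i j = 0 \<longrightarrow> i \<in> R' \<or> j \<in> C'"
  shows "card P \<le> card R' + card C'"
proof -
  note P' = transversal_zerosD[OF P]
  have finP: "finite P" using finite_subset[OF P'(1)] fin by simp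
  have "fst p \<in> R' \<or> snd p \<in> C'" if "p \<in> P" for p
  proof -
    have "fst p \<in> R" "snd p \<in> C" "B (fst p) (snd p) = 0"
      using that P'(1) P'(4)[of "fst p" "snd p"] by auto
    with cover show ?thesis by blast
  qed
  then have "card P \<le> card ({p \<in> P. fst p \<in> R'} \<union> {p \<in> P. snd p \<in> C'})"
    using finP by (intro card_mono) auto
  also have "\<dots> \<le> card {p \<in> P. fst p \<in> R'} + card {p \<in> P. snd p \<in> C'}"
    by (rule card_Un_le)
  finally have "card P \<le> card {p \<in> P. fst p \<in> R'} + card {p \<in> P. snd p \<in> C'}" .
  moreover have "card {p \<in> P. fst p \<in> R'} \<le> card R'"
    by (rule card_inj_on_le[OF inj_on_subset[OF P'(2)] _ finite_subset[OF sub(1) fin(1)]]) auto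
  moreover have "card {p \<in> P. snd p \<in> C'} \<le> card C'"
    by (rule card_inj_on_le[OF inj_on_subset[OF P'(3)] _ finite_subset[OF sub(2) fin(2)]]) auto
  ultimately show ?thesis by linarith
qed

text \<open>
  Each zero of a largest transversal family lies on exactly one line of a minimal cover, and
  each line of the cover contains one of them. The zeros in the columns outside \<open>C0\<close> therefore
  match those columns with the rows \<open>R0\<close>.
\<close>

lemma matching_of_covering_rows:
  assumes P: "transversal_zeros R C B P" and r: "card P = max_transversal R C B"
    and cover: "zero_cover R C B R0 C0" and fin: "finite R" "finite C"
    and Y1: "Y1 = {j \<in> snd ` P. j \<notin> C0}"
  obtains \<rho> where "bij_betw \<rho> R0 Y1" "\<And>i. i \<in> R0 \<Longrightarrow> B i (\<rho> i) = 0"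
proof -
  note P' = transversal_zerosD[OF P]
  have finP: "finite P" using finite_subset[OF P'(1)] fin by simp
  from cover have sub: "R0 \<subseteq> R" "C0 \<subseteq> C" and sum: "card P = card R0 + card C0"
    and cov: "\<forall>i\<in>R. \<forall>j\<in>C. B i j = 0 \<longrightarrow> i \<in> R0 \<or> j \<in> C0"
    using r by (auto simp: zero_cover_def)
  define P1 where "P1 = {p \<in> P. snd p \<notin> C0}"
  define P2 where "P2 = {p \<in> P. snd p \<in> C0}"
  have finR0: "finite R0" and finC0: "finite C0" using sub fin by (auto intro: finite_subset)
  have inj1: "inj_on fst P1" "inj_on snd P1"
    by (rule inj_on_subset[OF P'(2)], simp add: P1_def) (rule inj_on_subset[OF P'(3)], simp add: P1_def)
  have P1R0: "fst ` P1 \<subseteq> R0"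
  proof
    fix i assume "i \<in> fst ` P1"
    then obtain j where "(i, j) \<in> P" "j \<notin> C0" by (auto simp: P1_def)
    moreover from this have "i \<in> R" "j \<in> C" "B i j = 0" using P'(1,4) by auto
    ultimately show "i \<in> R0" using cov by blast
  qed
  have "card P2 \<le> card C0"
    by (rule card_inj_on_le[OF inj_on_subset[OF P'(3)] _ finC0]) (auto simp: P2_def)
  moreover have "card P1 \<le> card R0"
    using inj1 P1R0 finR0 by (intro card_inj_on_le[of fst]) auto
  moreover have "card P = card P1 + card P2"
  proof -
    have "P = P1 \<union> P2" "P1 \<inter> P2 = {}" by (auto simp: P1_def P2_def)
    with finP show ?thesis by (simp add: card_Un_disjoint)
  qed
  ultimately have "card R0 = card P1" using sum by linarith
  then have fst1: "fst ` P1 = R0"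
    using P1R0 finR0 inj1(1) by (metis card_image card_subset_eq)
  have bij: "bij_betw fst P1 R0" "bij_betw snd P1 Y1"
    using inj1 fst1 by (auto simp: bij_betw_def Y1 P1_def)
  show thesis
  proof
    show "bij_betw (snd \<circ> the_inv_into P1 fst) R0 Y1"
      using bij_betw_trans[OF bij_betw_the_inv_into[OF bij(1)] bij(2)] .
    fix i assume "i \<in> R0"
    with bij(1) obtain p where "p \<in> P1" "i = fst p" by (auto simp: bij_betw_def)
    then show "B i ((snd \<circ> the_inv_into P1 fst) i) = 0"
      using inj1(1) P'(4)[of "fst p" "snd p"] by (auto simp: the_inv_into_f_f P1_def)
  qed
qed

lemma HK_outputD:
  assumes HK: "HK_output R C B (R0, C0, Y1)" and fin: "finite R" "finite C"
  shows "R0 \<subseteq> R" "C0 \<subseteq> C" "Y1 \<subseteq> C" "\<And>i j. i \<in> R - R0 \<Longrightarrow> j \<in> C - C0 \<Longrightarrow> B i j \<noteq> 0"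
    "Y1 \<inter> C0 = {}"
    "\<exists>\<rho>. bij_betw \<rho> R0 Y1 \<and> (\<forall>i\<in>R0. B i (\<rho> i) = 0)"
proof -
  from HK obtain P where cover: "zero_cover R C B R0 C0"
    and P: "transversal_zeros R C B P" "card P = max_transversal R C B"
    and Y1: "Y1 = {j \<in> snd ` P. j \<notin> C0}"
    by (auto simp: HK_output_def)
  from cover show "R0 \<subseteq> R" "C0 \<subseteq> C" "\<And>i j. i \<in> R - R0 \<Longrightarrow> j \<in> C - C0 \<Longrightarrow> B i j \<noteq> 0"
    by (auto simp: zero_cover_def)
  show "Y1 \<subseteq> C" "Y1 \<inter> C0 = {}" using Y1 transversal_zerosD(1)[OF P(1)] by auto
  show "\<exists>\<rho>. bij_betw \<rho> R0 Y1 \<and> (\<forall>i\<in>R0. B i (\<rho> i) = 0)"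
    using matching_of_covering_rows[OF P cover fin Y1] by metis
qed

text \<open>
  Exchanging the columns of the matched block for its rows gives a cover that is not larger,
  so that a row-maximal minimal cover contains the rows of the block.
\<close>

lemma maximal_cover_contains_closed_block:
  assumes HK: "HK_output R C B (R0, C0, Y1)" and fin: "finite R" "finite C"
    and M: "M \<subseteq> R" and \<sigma>: "inj_on \<sigma> M" "\<sigma> ` M \<subseteq> C" "\<And>m. m \<in> M \<Longrightarrow> B m (\<sigma> m) = 0"
    and closed: "\<And>m i. m \<in> M \<Longrightarrow> i \<in> R - M \<Longrightarrow> B i (\<sigma> m) \<noteq> 0"
  shows "M \<subseteq> R0"
proof -
  from HK obtain P where cover: "zero_cover R C B R0 C0"
    and maximal: "\<And>R' C'. zero_cover R C B R' C' \<Longrightarrow> \<not> R0 \<subset> R'"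
    and P: "transversal_zeros R C B P" "card P = max_transversal R C B"
    by (auto simp: HK_output_def)
  from cover have sub: "R0 \<subseteq> R" "C0 \<subseteq> C" and sum: "card R0 + card C0 = max_transversal R C B"
    and cov: "\<forall>i\<in>R. \<forall>j\<in>C. B i j = 0 \<longrightarrow> i \<in> R0 \<or> j \<in> C0"
    by (auto simp: zero_cover_def)
  have finite: "finite R0" "finite C0" "finite M" using sub M fin by (auto intro: finite_subset)
  let ?R' = "R0 \<union> M" and ?C' = "C0 - \<sigma> ` M"
  have cov': "\<forall>i\<in>R. \<forall>j\<in>C. B i j = 0 \<longrightarrow> i \<in> ?R' \<or> j \<in> ?C'"
    using cov closed by blast
  (* A zero of the block in a row outside R0 must be covered by its column. *)
  have "card (M - R0) = card (\<sigma> ` (M - R0))"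
    using \<sigma>(1) by (metis Diff_subset card_image inj_on_subset)
  also have "\<dots> \<le> card (C0 \<inter> \<sigma> ` M)"
    using cov M \<sigma>(2,3) finite by (intro card_mono) blast+
  finally have "card (M - R0) \<le> card (C0 \<inter> \<sigma> ` M)" .
  moreover have "card ?R' = card R0 + card (M - R0)"
    using finite by (metis Diff_disjoint Un_Diff_cancel card_Un_disjoint finite_Diff)
  moreover have "card C0 = card ?C' + card (C0 \<inter> \<sigma> ` M)"
    using finite by (metis card_Diff_subset_Int card_mono finite_Int inf_le1 le_add_diff_inverse2)
  moreover have "card P \<le> card ?R' + card ?C'"
    using sub M by (intro card_transversal_le_cover[OF P(1) fin _ _ cov']) auto
  ultimately have "card ?R' + card ?C' = max_transversal R C B"
    using sum P(2) by linarith
  then have "zero_cover R C B ?R' ?C'"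
    using sub M cov' by (auto simp: zero_cover_def)
  from maximal[OF this] show ?thesis by blast
qed

section \<open>One step of the recursion\<close>

text \<open>
  Let an arrow lead from row \<open>x\<close> to row \<open>y\<close> if the entry of row \<open>x\<close> in the column \<open>\<sigma> y\<close> is not
  \<open>-\<infinity>\<close>. Rerouting \<open>\<sigma>\<close> along a cycle of arrows gives a bijection without entries \<open>-\<infinity>\<close>,
  so vanishing of the determinant makes all entries on cycles 0.
\<close>

lemma entries_on_cycles_vanish:
  fixes A :: entries
  assumes vanishing: "vanishing_det R Y A"
    and \<sigma>: "bij_betw \<sigma> R Y" "\<And>i. i \<in> R \<Longrightarrow> A i (\<sigma> i) = 0"
    and r: "r = (\<lambda>x y. x \<in> R \<and> y \<in> R \<and> A x (\<sigma> y) \<noteq> -\<infinity>)"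
    and path: "r\<^sup>*\<^sup>* y x" and arrow: "r x y"
  shows "A x (\<sigma> y) = 0"
proof -
  obtain xs where xs: "rtrancl_path r y xs x" "distinct (y # xs)"
  proof -
    from path obtain ys where "rtrancl_path r y ys x" unfolding rtranclp_eq_rtrancl_path by blast
    then show thesis by (rule rtrancl_path_distinct) (rule that)
  qed
  (* cs is a simple path from y to x, which the arrow from x to y closes to a cycle. *)
  define cs where "cs = y # xs"
  define \<pi> where "\<pi> = cycle_of_list cs"
  have dist: "distinct cs" using xs(2) by (simp add: cs_def)
  have last: "last cs = x"
    using xs(1) rtrancl_path_last[OF xs(1)] by (cases xs) (auto simp: cs_def elim: rtrancl_path.cases)
  have arrows: "r (cs ! k) (cs ! Suc k)" if "Suc k < length cs" for k
    using rtrancl_path_nth[OF xs(1), of k] that by (simp add: cs_def)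
  have csR: "set cs \<subseteq> R"
  proof
    fix z assume "z \<in> set cs"
    then consider "z = y" | "z \<in> set xs" by (auto simp: cs_def)
    then show "z \<in> R"
    proof cases
      case 1 then show ?thesis using arrow r by simp
    next
      case 2
      then have "Rangep r z" using rtrancl_path_Range[OF xs(1)] by blast
      then show ?thesis using r by auto
    qed
  qed
  have "\<pi> permutes R"
    unfolding \<pi>_def using cycle_permutes csR by (rule permutes_subset)
  then have bij: "bij_betw (\<sigma> \<circ> \<pi>) R Y"
    using \<sigma>(1) by (metis bij_betw_trans permutes_imp_bij)
  have rot: "\<pi> (cs ! k) = cs ! (Suc k mod length cs)" if "k < length cs" for k
  proof -
    have "map \<pi> cs = rotate1 cs"
      using cyclic_rotation[OF dist, of 1] by (simp add: \<pi>_def)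
    then show ?thesis using that by (metis nth_map nth_rotate1)
  qed
  have step: "r z (\<pi> z)" if "z \<in> set cs" for z
  proof -
    from that obtain k where k: "k < length cs" "z = cs ! k" by (auto simp: in_set_conv_nth)
    show ?thesis
    proof (cases "Suc k < length cs")
      case True
      with k rot arrows show ?thesis by simp
    next
      case False
      (* Indices are taken modulo the length: the last row of the cycle is sent to the first. *)
      with k have "k = length cs - 1" by simp
      then have "z = x" "\<pi> z = y"
        using k rot[of k] last by (auto simp: cs_def last_conv_nth)
      with arrow show ?thesis by simp
    qed
  qed
  have "\<forall>i\<in>R. A i ((\<sigma> \<circ> \<pi>) i) \<noteq> -\<infinity>"
  proof
    fix i assume "i \<in> R"
    show "A i ((\<sigma> \<circ> \<pi>) i) \<noteq> -\<infinity>"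
    proof (cases "i \<in> set cs")
      case True then show ?thesis using step[of i] r by simp
    next
      case False
      then have "\<pi> i = i" by (simp add: \<pi>_def id_outside_supp)
      then show ?thesis using \<sigma>(2)[OF \<open>i \<in> R\<close>] by simp
    qed
  qed
  then have zero: "\<forall>i\<in>R. A i ((\<sigma> \<circ> \<pi>) i) = 0" using vanishing bij unfolding vanishing_det_def by blast
  have "x \<in> R" using arrow r by simp
  moreover have "\<pi> x = y"
    using rot[of "length cs - 1"] last last_conv_nth[of cs] by (auto simp: cs_def)
  ultimately show ?thesis using zero by auto
qed

text \<open>
  An initial strongly connected component of the graph of arrows is the wanted block: no arrow
  enters it from outside, and all arrows inside it lie on cycles.
\<close>

lemma vanishing_det_closed_block:
  fixes A :: entries
  assumes fin: "finite R" and ne: "R \<noteq> {}" and vanishing: "vanishing_det R Y A"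
    and \<sigma>: "bij_betw \<sigma> R Y" "\<And>i. i \<in> R \<Longrightarrow> A i (\<sigma> i) = 0"
  shows "\<exists>M\<subseteq>R. M \<noteq> {} \<and> (\<forall>m\<in>M. \<forall>i\<in>R. A i (\<sigma> m) = 0 \<or> A i (\<sigma> m) = -\<infinity>) \<and>
    (\<forall>m\<in>M. \<forall>i\<in>R - M. A i (\<sigma> m) = -\<infinity>)"
proof -
  define r where "r = (\<lambda>x y. x \<in> R \<and> y \<in> R \<and> A x (\<sigma> y) \<noteq> -\<infinity>)"
  define pred where "pred = (\<lambda>y. {x \<in> R. r\<^sup>*\<^sup>* x y})"
  obtain y where y: "y \<in> R" and least: "\<And>z. z \<in> R \<Longrightarrow> card (pred y) \<le> card (pred z)"
    using ex_has_least_nat[of "\<lambda>y. y \<in> R" _ "\<lambda>y. card (pred y)"] ne by blast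
  (* Minimality makes the predecessors of y mutually reachable: an initial component. *)
  have returns: "r\<^sup>*\<^sup>* y z" if "z \<in> pred y" for z
  proof -
    have "pred z \<subseteq> pred y" using that by (auto simp: pred_def)
    moreover have "finite (pred y)" "card (pred y) \<le> card (pred z)"
      using fin least that by (auto simp: pred_def)
    ultimately have "pred z = pred y" by (meson card_seteq)
    with y show ?thesis by (auto simp: pred_def)
  qed
  have closed: "x \<in> pred y" if "m \<in> pred y" "r x m" for m x
    using that by (auto simp: pred_def r_def intro: converse_rtranclp_into_rtranclp)
  have zero: "A i (\<sigma> m) = 0" if "m \<in> pred y" "r i m" for m i
  proof (rule entries_on_cycles_vanish[OF vanishing \<sigma> r_def])
    show "r\<^sup>*\<^sup>* m i"
      using that closed[OF that] returns by (auto simp: pred_def intro: rtranclp_trans)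
    show "r i m" by fact
  qed
  have "pred y \<subseteq> R" "pred y \<noteq> {}" using y by (auto simp: pred_def)
  moreover have "\<forall>m\<in>pred y. \<forall>i\<in>R. A i (\<sigma> m) = 0 \<or> A i (\<sigma> m) = -\<infinity>"
  proof (intro ballI)
    fix m i assume mi: "m \<in> pred y" "i \<in> R"
    show "A i (\<sigma> m) = 0 \<or> A i (\<sigma> m) = -\<infinity>"
    proof (cases "r i m")
      case True
      then show ?thesis using zero mi(1) by blast
    next
      case False
      then show ?thesis using mi by (simp add: r_def pred_def)
    qed
  qed
  moreover have "\<forall>m\<in>pred y. \<forall>i\<in>R - pred y. A i (\<sigma> m) = -\<infinity>"
  proof (intro ballI)
    fix m i assume mi: "m \<in> pred y" "i \<in> R - pred y"
    then have "\<not> r i m" using closed[OF mi(1)] by blast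
    then show "A i (\<sigma> m) = -\<infinity>" using mi by (simp add: r_def pred_def)
  qed
  ultimately have "pred y \<subseteq> R \<and> pred y \<noteq> {} \<and>
      (\<forall>m\<in>pred y. \<forall>i\<in>R. A i (\<sigma> m) = 0 \<or> A i (\<sigma> m) = -\<infinity>) \<and>
      (\<forall>m\<in>pred y. \<forall>i\<in>R - pred y. A i (\<sigma> m) = -\<infinity>)"
    by (intro conjI)
  then show ?thesis by (rule exI)
qed

text \<open>
  Soundness of the recursion: in the rows outside \<open>R0\<close> the columns \<open>Y1\<close> contain only \<open>-\<infinity>\<close>,
  so a bijection onto \<open>Y2 \<union> Y1\<close> without entries \<open>-\<infinity>\<close> splits into one of \<open>R0\<close> onto \<open>Y1\<close>
  and one of the other rows onto \<open>Y2\<close>.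
\<close>

lemma vanishing_det_extend:
  assumes fin: "finite R" and R0: "R0 \<subseteq> R"
    and \<rho>: "bij_betw \<rho> R0 Y1" "\<And>i. i \<in> R0 \<Longrightarrow> A i (\<rho> i) = 0"
    and low: "\<And>i j. i \<in> R - R0 \<Longrightarrow> j \<in> Y1 \<Longrightarrow> A i j = -\<infinity>"
    and nonpos: "\<And>i j. i \<in> R0 \<Longrightarrow> j \<in> Y1 \<Longrightarrow> A i j = 0 \<or> A i j = -\<infinity>"
    and Y2: "vanishing_det (R - R0) Y2 A"
  shows "vanishing_det R (Y2 \<union> Y1) A" "Y2 \<inter> Y1 = {}"
proof -
  from Y2 obtain \<sigma> where \<sigma>: "bij_betw \<sigma> (R - R0) Y2" "\<And>i. i \<in> R - R0 \<Longrightarrow> A i (\<sigma> i) = 0"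
    by (auto simp: vanishing_det_def)
  show disj: "Y2 \<inter> Y1 = {}"
    using \<sigma> low by (force simp: bij_betw_def)
  have R: "(R - R0) \<union> R0 = R" using R0 by blast
  have "bij_betw (\<lambda>i. if i \<in> R - R0 then \<sigma> i else \<rho> i) R (Y2 \<union> Y1)"
    using bij_betw_disjoint_Un[OF \<sigma>(1) \<rho>(1) _ disj] R by auto
  moreover have "\<forall>i\<in>R. A i (if i \<in> R - R0 then \<sigma> i else \<rho> i) = 0"
    using \<sigma>(2) \<rho>(2) by auto
  ultimately have ex: "\<exists>\<sigma>. bij_betw \<sigma> R (Y2 \<union> Y1) \<and> (\<forall>i\<in>R. A i (\<sigma> i) = 0)" by blast
  have "\<forall>i\<in>R. A i (\<tau> i) = 0"
    if \<tau>: "bij_betw \<tau> R (Y2 \<union> Y1)" and finite: "\<forall>i\<in>R. A i (\<tau> i) \<noteq> -\<infinity>" for \<tau>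
  proof -
    have inj: "inj_on \<tau> R" and img: "\<tau> ` R = Y2 \<union> Y1" using \<tau> by (auto simp: bij_betw_def)
    have Y1sub: "Y1 \<subseteq> \<tau> ` R0"
    proof
      fix j assume "j \<in> Y1"
      then obtain i where "i \<in> R" "\<tau> i = j" using img by (metis UnCI imageE)
      then show "j \<in> \<tau> ` R0" using low finite \<open>j \<in> Y1\<close> by blast
    qed
    have finR0: "finite R0" using fin R0 finite_subset by blast
    have "card (\<tau> ` R0) = card Y1"
      using card_image[OF inj_on_subset[OF inj R0]] bij_betw_same_card[OF \<rho>(1)] by simp
    with Y1sub have imR0: "\<tau> ` R0 = Y1" using finR0 by (metis card_subset_eq finite_imageI)
    have "\<tau> ` (R - R0) = Y2"
      using inj_on_image_set_diff[OF inj _ R0, of R] img imR0 disj by auto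
    then have "bij_betw \<tau> (R - R0) Y2"
      using inj_on_subset[OF inj Diff_subset] by (simp add: bij_betw_def)
    then have "\<forall>i\<in>R - R0. A i (\<tau> i) = 0"
      using Y2 finite by (auto simp: vanishing_det_def)
    moreover have "\<forall>i\<in>R0. A i (\<tau> i) = 0"
      using nonpos finite imR0 R0 by blast
    ultimately show ?thesis by blast
  qed
  with ex show "vanishing_det R (Y2 \<union> Y1) A" unfolding vanishing_det_def by blast
qed

text \<open>
  A competitor on the rows \<open>R'\<close> extends by \<open>\<sigma>\<close> to one on all rows, so that completeness holds
  for every choice of suppressed rows.
\<close>

lemma vanishing_det_restrict:
  assumes \<sigma>: "bij_betw \<sigma> R Y" "\<And>i. i \<in> R \<Longrightarrow> A i (\<sigma> i) = 0" and van: "vanishing_det R Y A"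
    and R': "R' \<subseteq> R"
  shows "vanishing_det R' (\<sigma> ` R') A"
proof -
  have inj: "inj_on \<sigma> R" and img: "\<sigma> ` R = Y" using \<sigma>(1) by (auto simp: bij_betw_def)
  have b': "bij_betw \<sigma> R' (\<sigma> ` R')" using inj_on_subset[OF inj R'] by (rule inj_on_imp_bij_betw)
  have rest: "bij_betw \<sigma> (R - R') (\<sigma> ` (R - R'))"
    using inj_on_subset[OF inj Diff_subset] by (rule inj_on_imp_bij_betw)
  have disj: "\<sigma> ` R' \<inter> \<sigma> ` (R - R') = {}" using inj R' by (auto dest: inj_onD)
  have "\<forall>i\<in>R'. A i (\<tau> i) = 0"
    if \<tau>: "bij_betw \<tau> R' (\<sigma> ` R')" and finite: "\<forall>i\<in>R'. A i (\<tau> i) \<noteq> -\<infinity>" for \<tau>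
  proof -
    let ?\<tau> = "\<lambda>i. if i \<in> R' then \<tau> i else \<sigma> i"
    have "R' \<union> (R - R') = R" "\<sigma> ` R' \<union> \<sigma> ` (R - R') = Y" using R' img by auto
    then have "bij_betw ?\<tau> R Y" using bij_betw_disjoint_Un[OF \<tau> rest _ disj] by auto
    moreover have "\<forall>i\<in>R. A i (?\<tau> i) \<noteq> -\<infinity>" using finite \<sigma>(2) by auto
    ultimately have "\<forall>i\<in>R. A i (?\<tau> i) = 0" using van unfolding vanishing_det_def by blast
    with R' show ?thesis by force
  qed
  with b' \<sigma>(2) R' show ?thesis unfolding vanishing_det_def by blast
qed

lemma vanishing_det_card: "vanishing_det R Y A \<Longrightarrow> card Y = card R"
  by (auto simp: vanishing_det_def dest: bij_betw_same_card)

context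
  fixes R C C' CB R0 C0 Y1 :: "nat set" and A :: entries
  assumes fin: "finite R" "finite C"
    and C': "C' = {j \<in> C. \<exists>i\<in>R. A i j \<noteq> -\<infinity>}"
    and CB: "CB = {j \<in> C'. \<forall>i\<in>R. A i j = 0 \<or> A i j = -\<infinity>}"
    and HK: "HK_output R CB A (R0, C0, Y1)"
begin

lemma finite_zero_columns: "finite CB"
  using fin by (simp add: C' CB)

text \<open>
  The rows outside \<open>R0\<close> contain no zero in the columns \<open>Y1\<close>, which avoid \<open>C0\<close>; as these columns
  contain only 0 and \<open>-\<infinity>\<close>, the entries there are \<open>-\<infinity>\<close>.
\<close>

lemma recursion_sound:
  assumes "Y2 \<subseteq> C'" "vanishing_det (R - R0) Y2 A"
  shows "Y2 \<union> Y1 \<subseteq> C" "vanishing_det R (Y2 \<union> Y1) A"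
proof -
  note HK' = HK_outputD[OF HK fin(1) finite_zero_columns]
  show "Y2 \<union> Y1 \<subseteq> C" using assms(1) HK'(3) by (auto simp: C' CB)
  from HK'(6) obtain \<rho> where \<rho>: "bij_betw \<rho> R0 Y1" "\<forall>i\<in>R0. A i (\<rho> i) = 0" by blast
  show "vanishing_det R (Y2 \<union> Y1) A"
  proof (rule vanishing_det_extend[OF fin(1) HK'(1) \<rho>(1) _ _ _ assms(2)])
    show "A i (\<rho> i) = 0" if "i \<in> R0" for i using \<rho>(2) that by blast
    show "A i j = -\<infinity>" if "i \<in> R - R0" "j \<in> Y1" for i j
    proof -
      have "j \<in> CB - C0" using HK'(3,5) that(2) by blast
      with HK'(4)[OF that(1)] that(1) show ?thesis by (auto simp: CB)
    qed
    show "A i j = 0 \<or> A i j = -\<infinity>" if "i \<in> R0" "j \<in> Y1" for i j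
      using HK'(1,3) that by (auto simp: CB)
  qed
qed

text \<open>
  The block of the component lies in \<open>B\<close> and forces its rows into \<open>R0\<close>. The rows that remain keep
  their columns under \<open>\<sigma>\<close>, none of which is a column of \<open>-\<infinity>\<close>.
\<close>

lemma recursion_complete:
  assumes ne: "R \<noteq> {}" and Y: "Y \<subseteq> C" "vanishing_det R Y A"
  shows "R0 \<noteq> {}" "\<exists>Y2\<subseteq>C'. vanishing_det (R - R0) Y2 A"
proof -
  from Y(2) obtain \<sigma> where \<sigma>: "bij_betw \<sigma> R Y" "\<And>i. i \<in> R \<Longrightarrow> A i (\<sigma> i) = 0"
    unfolding vanishing_det_def by blast
  have inj: "inj_on \<sigma> R" and img: "\<sigma> ` R = Y" using \<sigma>(1) by (auto simp: bij_betw_def)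
  have live: "\<sigma> i \<in> C'" if "i \<in> R" for i
  proof -
    have "A i (\<sigma> i) \<noteq> -\<infinity>" using \<sigma>(2)[OF that] by simp
    then show ?thesis using that img Y(1) by (auto simp: C')
  qed
  obtain M where M: "M \<subseteq> R" "M \<noteq> {}"
    "\<And>m i. m \<in> M \<Longrightarrow> i \<in> R \<Longrightarrow> A i (\<sigma> m) = 0 \<or> A i (\<sigma> m) = -\<infinity>"
    "\<And>m i. m \<in> M \<Longrightarrow> i \<in> R - M \<Longrightarrow> A i (\<sigma> m) = -\<infinity>"
    using vanishing_det_closed_block[of R Y A \<sigma>] fin(1) ne Y(2) \<sigma> by metis
  have "M \<subseteq> R0"
  proof (rule maximal_cover_contains_closed_block[OF HK fin(1) finite_zero_columns M(1)])
    show "inj_on \<sigma> M" using inj M(1) by (rule inj_on_subset)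
    show "\<sigma> ` M \<subseteq> CB" using M(1,3) live by (auto simp: CB)
    show "A m (\<sigma> m) = 0" if "m \<in> M" for m using \<sigma>(2) M(1) that by blast
    show "A i (\<sigma> m) \<noteq> 0" if "m \<in> M" "i \<in> R - M" for m i using M(4)[OF that] by simp
  qed
  then show "R0 \<noteq> {}" using M(2) by blast
  have "vanishing_det (R - R0) (\<sigma> ` (R - R0)) A"
    using vanishing_det_restrict[OF \<sigma> Y(2)] by blast
  moreover have "\<sigma> ` (R - R0) \<subseteq> C'" using live by blast
  ultimately show "\<exists>Y2\<subseteq>C'. vanishing_det (R - R0) Y2 A" by blast
qed

end

section \<open>Runs of the algorithm\<close>

lemma fst_runs [simp]:
  "fst (bind_run m f) = fst (f (fst m))" "fst (return x) = x" "fst (tick k) = ()" "fst enter = ()"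
  "fst (run_sub y) = fst y" "fst (run_HK hk R C B) = fst (hk R C B)"
  "fst (read A i j) = A i j" "fst (member_run S i) = (i \<in> S)"
  by (simp_all add: bind_run_def return_def tick_def enter_def run_sub_def run_HK_def read_def
      member_run_def)

lemma operations_runs [simp]:
  "operations (bind_run m f) = operations m + operations (f (fst m))" "operations (return x) = 0"
  "operations (tick k) = k" "operations enter = 1" "operations (run_sub y) = snd y"
  "operations (run_HK hk R C B) = snd (hk R C B)"
  "operations (read A i j) = 1" "operations (member_run S i) = 1"
  by (simp_all add: operations_def bind_run_def return_def tick_def enter_def run_sub_def
      run_HK_def read_def member_run_def)

lemma HK_calls_runs [simp]:
  "HK_calls (bind_run m f) = HK_calls m @ HK_calls (f (fst m))" "HK_calls (return x) = []"
  "HK_calls (tick k) = []" "HK_calls enter = []" "HK_calls (run_sub y) = []"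
  "HK_calls (run_HK hk R C B) = [HK_Call R C B (fst (hk R C B)) (snd (hk R C B))]"
  "HK_calls (read A i j) = []" "HK_calls (member_run S i) = []"
  by (simp_all add: HK_calls_def bind_run_def return_def tick_def enter_def run_sub_def
      run_HK_def read_def member_run_def)

lemma main_calls_runs [simp]:
  "main_calls (bind_run m f) = main_calls m + main_calls (f (fst m))" "main_calls (return x) = 0"
  "main_calls (tick k) = 0" "main_calls enter = 1" "main_calls (run_sub y) = 0"
  "main_calls (run_HK hk R C B) = 0"
  "main_calls (read A i j) = 0" "main_calls (member_run S i) = 0"
  by (simp_all add: main_calls_def bind_run_def return_def tick_def enter_def run_sub_def
      run_HK_def read_def member_run_def)

declare fst_filter_run [simp]

lemma fst_exists_run [simp]: "fst (exists_run p xs) \<longleftrightarrow> (\<exists>x\<in>set xs. fst (p x))"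
  by (induction xs) auto

lemma HK_calls_loops [simp]:
  assumes "\<And>x. HK_calls (p x) = []"
  shows "HK_calls (filter_run p xs) = []" "HK_calls (exists_run p xs) = []"
  using assms by (induction xs) auto

lemma main_calls_loops [simp]:
  assumes "\<And>x. main_calls (p x) = 0"
  shows "main_calls (filter_run p xs) = 0" "main_calls (exists_run p xs) = 0"
  using assms by (induction xs) auto

lemma operations_filter_run:
  assumes "\<And>x. x \<in> set xs \<Longrightarrow> real (operations (p x)) \<le> k"
  shows "real (operations (filter_run p xs)) \<le> real (length xs) * (1 + k)"
  using assms
proof (induction xs)
  case (Cons x xs)
  have "real (operations (filter_run p xs)) \<le> real (length xs) * (1 + k)" "real (operations (p x)) \<le> k"
    using Cons by auto
  then show ?case by (simp add: algebra_simps)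
qed simp

lemma operations_exists_run:
  assumes "\<And>x. x \<in> set xs \<Longrightarrow> operations (p x) \<le> k"
  shows "operations (exists_run p xs) \<le> length xs * (1 + k)"
  using assms
proof (induction xs)
  case (Cons x xs)
  have "operations (exists_run p xs) \<le> length xs * (1 + k)" "operations (p x) \<le> k"
    using Cons by auto
  then show ?case by auto
qed simp

lemma fst_tests [simp]:
  "fst (row_has_zero A C i) \<longleftrightarrow> (\<exists>j\<in>set C. A i j = 0)"
  "fst (some_row_without_zero A R C) \<longleftrightarrow> (\<exists>i\<in>set R. \<forall>j\<in>set C. A i j \<noteq> 0)"
  "fst (col_not_minf A R j) \<longleftrightarrow> (\<exists>i\<in>set R. A i j \<noteq> -\<infinity>)"
  "fst (col_only_zero_minf A R j) \<longleftrightarrow> (\<forall>i\<in>set R. A i j = 0 \<or> A i j = -\<infinity>)"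
  by (auto simp: row_has_zero_def some_row_without_zero_def col_not_minf_def col_only_zero_minf_def)

lemma HK_calls_tests [simp]:
  "HK_calls (row_has_zero A C i) = []" "HK_calls (some_row_without_zero A R C) = []"
  "HK_calls (col_not_minf A R j) = []" "HK_calls (col_only_zero_minf A R j) = []"
  by (simp_all add: row_has_zero_def some_row_without_zero_def col_not_minf_def col_only_zero_minf_def)

lemma main_calls_tests [simp]:
  "main_calls (row_has_zero A C i) = 0" "main_calls (some_row_without_zero A R C) = 0"
  "main_calls (col_not_minf A R j) = 0" "main_calls (col_only_zero_minf A R j) = 0"
  by (simp_all add: row_has_zero_def some_row_without_zero_def col_not_minf_def col_only_zero_minf_def)

lemma operations_tests:
  "operations (row_has_zero A C i) \<le> 2 * length C"
  "operations (some_row_without_zero A R C) \<le> length R * (1 + 2 * length C)"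
  "operations (col_not_minf A R j) \<le> 2 * length R"
  "operations (col_only_zero_minf A R j) \<le> 2 * length R"
proof -
  show row: "operations (row_has_zero A C i) \<le> 2 * length C" for i
    using operations_exists_run[of C "\<lambda>j. do { x \<leftarrow> read A i j; return (x = 0) }" 1]
    by (simp add: row_has_zero_def)
  show "operations (some_row_without_zero A R C) \<le> length R * (1 + 2 * length C)"
    unfolding some_row_without_zero_def by (rule operations_exists_run) (simp add: row)
  show "operations (col_not_minf A R j) \<le> 2 * length R"
    using operations_exists_run[of R "\<lambda>i. do { x \<leftarrow> read A i j; return (x \<noteq> -\<infinity>) }" 1]
    by (simp add: col_not_minf_def)
  show "operations (col_only_zero_minf A R j) \<le> 2 * length R"
    using operations_exists_run[of R "\<lambda>i. do { x \<leftarrow> read A i j; return (x \<noteq> 0 \<and> x \<noteq> -\<infinity>) }" 1]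
    by (simp add: col_only_zero_minf_def)
qed

definition live_cols :: "entries \<Rightarrow> nat list \<Rightarrow> nat list \<Rightarrow> nat list" where
  "live_cols A R C = filter (\<lambda>j. \<exists>i\<in>set R. A i j \<noteq> -\<infinity>) C"

definition zero_cols :: "entries \<Rightarrow> nat list \<Rightarrow> nat list \<Rightarrow> nat list" where
  "zero_cols A R C = filter (\<lambda>j. \<forall>i\<in>set R. A i j = 0 \<or> A i j = -\<infinity>) (live_cols A R C)"

text \<open>
  The case \<open>R = []\<close> is excluded because the call then succeeds at once.
\<close>

definition reaches_HK :: "entries \<Rightarrow> nat list \<Rightarrow> nat list \<Rightarrow> bool" where
  "reaches_HK A R C \<longleftrightarrow>
     length R \<le> length C \<and> R \<noteq> [] \<and> (\<forall>i\<in>set R. \<exists>j\<in>set C. A i j = 0)"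

text \<open>
  A call that stops before the subroutine needs no induction, while the others are reduced to a
  recursive call; this lemma and the next unfold the program in the two cases.
\<close>

lemma O_test_stop:
  assumes "\<not> reaches_HK A R C"
  shows "fst (O_test hk A R C) = (if R = [] then Some {} else None)"
    "HK_calls (O_test hk A R C) = []" "main_calls (O_test hk A R C) = 1"
    "operations (O_test hk A R C) \<le> 1 + length R + length C + length R * (1 + 2 * length C)"
proof -
  have *: "length R > length C \<or> R = [] \<or> (\<exists>i\<in>set R. \<forall>j\<in>set C. A i j \<noteq> 0)"
    using assms by (auto simp: reaches_HK_def)
  then show "fst (O_test hk A R C) = (if R = [] then Some {} else None)"
    "HK_calls (O_test hk A R C) = []" "main_calls (O_test hk A R C) = 1"
    by (auto simp: O_test.simps[of hk A R C])
  show "operations (O_test hk A R C) \<le> 1 + length R + length C + length R * (1 + 2 * length C)"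
    using * operations_tests(2)[of A R C] by (auto simp: O_test.simps[of hk A R C])
qed

lemma O_test_step:
  fixes A :: entries
  assumes reach: "reaches_HK A R C" and out: "fst (hk R (zero_cols A R C) A) = (R0, C0, Y1)"
  defines "call \<equiv> HK_Call R (zero_cols A R C) A (R0, C0, Y1) (snd (hk R (zero_cols A R C) A))"
    and "m' \<equiv> O_test hk A (filter (\<lambda>i. i \<notin> R0) R) (live_cols A R C)"
  shows "fst (O_test hk A R C) =
      (if set R \<inter> R0 = {} then None else map_option (\<lambda>Y2. Y2 \<union> Y1) (fst m'))"
    "HK_calls (O_test hk A R C) = call # (if set R \<inter> R0 = {} then [] else HK_calls m')"
    "main_calls (O_test hk A R C) = 1 + (if set R \<inter> R0 = {} then 0 else main_calls m')"
    "card Y1 \<le> length C \<Longrightarrow> operations (O_test hk A R C) \<le>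
      2 + 6 * length R + 4 * length C + 8 * length R * length C + snd (hk R (zero_cols A R C) A)
        + (if set R \<inter> R0 = {} then 0 else operations m')"
proof -
  have "\<not> length C < length R" "R \<noteq> []" "\<not> (\<exists>i\<in>set R. \<forall>j\<in>set C. A i j \<noteq> 0)"
    using reach by (auto simp: reaches_HK_def)
  note cond = this
  have empty: "filter (\<lambda>i. i \<in> R0) R = [] \<longleftrightarrow> set R \<inter> R0 = {}"
    by (auto simp: filter_empty_conv)
  note unfold = O_test.simps[of hk A R C] cond live_cols_def[symmetric] zero_cols_def[symmetric] empty
    out copy_submatrix_def
  show "fst (O_test hk A R C) =
      (if set R \<inter> R0 = {} then None else map_option (\<lambda>Y2. Y2 \<union> Y1) (fst m'))"
    unfolding m'_def by (auto simp: unfold split: option.splits)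
  show "HK_calls (O_test hk A R C) = call # (if set R \<inter> R0 = {} then [] else HK_calls m')"
    unfolding m'_def call_def by (auto simp: unfold split: option.splits)
  show "main_calls (O_test hk A R C) = 1 + (if set R \<inter> R0 = {} then 0 else main_calls m')"
    unfolding m'_def by (auto simp: unfold split: option.splits)
  assume Y1: "card Y1 \<le> length C"
  have filter_cost: "operations (filter_run p xs) \<le> length xs * (1 + k)"
    if "\<And>x. x \<in> set xs \<Longrightarrow> operations (p x) \<le> k" for p :: "nat \<Rightarrow> bool run" and xs k
    using operations_filter_run[of xs p "real k"] that
    by (metis (no_types, lifting) of_nat_1 of_nat_add of_nat_le_iff of_nat_mult)
  have len: "length (live_cols A R C) \<le> length C" "length (zero_cols A R C) \<le> length C"
    "length (filter (\<lambda>i. i \<notin> R0) R) \<le> length R"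
    by (auto simp: live_cols_def zero_cols_def intro: order_trans[OF length_filter_le])
  have c1: "operations (some_row_without_zero A R C) \<le> length R * (1 + 2 * length C)"
    by (rule operations_tests(2))
  have c2: "operations (filter_run (col_not_minf A R) C) \<le> length C * (1 + 2 * length R)"
    by (rule filter_cost) (rule operations_tests(3))
  have "operations (filter_run (col_only_zero_minf A R) (live_cols A R C))
      \<le> length (live_cols A R C) * (1 + 2 * length R)"
    by (rule filter_cost) (rule operations_tests(4))
  also have "\<dots> \<le> length C * (1 + 2 * length R)" using len(1) by (rule mult_le_mono1)
  finally have c3: "operations (filter_run (col_only_zero_minf A R) (live_cols A R C))
      \<le> length C * (1 + 2 * length R)" .
  have c4: "length R * length (zero_cols A R C) \<le> length R * length C"
    using len(2) by (rule mult_le_mono2)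
  have c5: "operations (filter_run (member_run R0) R) \<le> length R * 2"
    using filter_cost[of R "member_run R0" 1] by simp
  have c6: "operations (filter_run (\<lambda>i. do { b \<leftarrow> member_run R0 i; return (\<not> b) }) R) \<le> length R * 2"
    using filter_cost[of R "\<lambda>i. do { b \<leftarrow> member_run R0 i; return (\<not> b) }" 1] by simp
  have c7: "length (filter (\<lambda>i. i \<notin> R0) R) * length (live_cols A R C) \<le> length R * length C"
    using len(1,3) by (rule mult_le_mono[rotated])
  (* As atoms, these products make the final estimate linear. *)
  define z where "z = length R * length (zero_cols A R C)"
  define w where "w = length (filter (\<lambda>i. i \<notin> R0) R) * length (live_cols A R C)"
  have "operations (O_test hk A R C) \<le> 1 + (length R + length C) +
      operations (some_row_without_zero A R C) + operations (filter_run (col_not_minf A R) C) +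
      operations (filter_run (col_only_zero_minf A R) (live_cols A R C)) +
      z + snd (hk R (zero_cols A R C) A) + operations (filter_run (member_run R0) R) +
      (if set R \<inter> R0 = {} then 0 else
        operations (filter_run (\<lambda>i. do { b \<leftarrow> member_run R0 i; return (\<not> b) }) R) +
        w + operations m' + (1 + card Y1))"
    unfolding m'_def z_def w_def by (auto simp: unfold split: option.splits)
  also have "\<dots> \<le> 2 + 6 * length R + 4 * length C + 8 * length R * length C
      + snd (hk R (zero_cols A R C) A) + (if set R \<inter> R0 = {} then 0 else operations m')"
    using c1 c2 c3 c4[folded z_def] c5 c6 c7[folded w_def] Y1 by (simp add: algebra_simps)
  finally show "operations (O_test hk A R C) \<le>
      2 + 6 * length R + 4 * length C + 8 * length R * length C + snd (hk R (zero_cols A R C) A)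
        + (if set R \<inter> R0 = {} then 0 else operations m')" .
qed

lemma zero_cols_entries: "entries_in {0, -\<infinity>} (set R) (set (zero_cols A R C)) A"
  by (auto simp: entries_in_def zero_cols_def)

lemma zero_cols_sub: "set (zero_cols A R C) \<subseteq> set (live_cols A R C)" "set (live_cols A R C) \<subseteq> set C"
  by (auto simp: zero_cols_def live_cols_def)

lemma distinct_cols: "distinct C \<Longrightarrow> distinct (live_cols A R C)" "distinct C \<Longrightarrow> distinct (zero_cols A R C)"
  by (simp_all add: zero_cols_def live_cols_def)

lemma HK_correct_step:
  assumes "HK_correct hk" "distinct R" "distinct C" "fst (hk R (zero_cols A R C) A) = (R0, C0, Y1)"
  shows "HK_output (set R) (set (zero_cols A R C)) A (R0, C0, Y1)"
  using assms zero_cols_entries[of R A C] distinct_cols(2)[of C A R] unfolding HK_correct_def by metis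

lemma HK_step_facts:
  assumes "HK_correct hk" "distinct R" "distinct C" "fst (hk R (zero_cols A R C) A) = (R0, C0, Y1)"
  shows "R0 \<subseteq> set R" "card Y1 \<le> length C"
proof -
  note HK = HK_outputD[OF HK_correct_step[OF assms]]
  show "R0 \<subseteq> set R" using HK(1) by simp
  have "Y1 \<subseteq> set C" using HK(3) zero_cols_sub[of A R C] by auto
  then show "card Y1 \<le> length C" by (meson card_length card_mono finite_set le_trans)
qed

text \<open>
  Induction on the number of rows. A call that fails before it reaches the subroutine is right to do
  so, since a bijection meeting only zeros needs a zero in each row and enough columns.
\<close>

lemma O_test_result:
  assumes "HK_correct hk" "distinct R" "distinct C"
  shows "case fst (O_test hk A R C) of
      None \<Rightarrow> \<not> (\<exists>Y\<subseteq>set C. vanishing_det (set R) Y A)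
    | Some Y \<Rightarrow> Y \<subseteq> set C \<and> vanishing_det (set R) Y A"
  using assms
proof (induction "length R" arbitrary: R C rule: less_induct)
  case less
  show ?case
  proof (cases "reaches_HK A R C")
    case False
    show ?thesis
    proof (cases "R = []")
      case True
      then show ?thesis
        unfolding O_test_stop(1)[OF False] by (simp add: vanishing_det_def bij_betw_def)
    next
      case ne: False
      have False if Y: "Y \<subseteq> set C" "vanishing_det (set R) Y A" for Y
      proof -
        from Y(2) obtain \<sigma> where \<sigma>: "bij_betw \<sigma> (set R) Y" "\<forall>i\<in>set R. A i (\<sigma> i) = 0"
          by (auto simp: vanishing_det_def)
        have "length R = card Y" using vanishing_det_card[OF Y(2)] less.prems(2)
          by (simp add: distinct_card)
        also have "\<dots> \<le> length C" using Y(1) by (meson card_length card_mono finite_set le_trans)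
        finally have "length R \<le> length C" .
        moreover have "\<forall>i\<in>set R. \<exists>j\<in>set C. A i j = 0"
          using \<sigma> Y(1) by (auto simp: bij_betw_def)
        ultimately show False using False ne by (auto simp: reaches_HK_def)
      qed
      with ne show ?thesis by (auto simp: O_test_stop[OF False])
    qed
  next
    case True
    obtain R0 C0 Y1 where out: "fst (hk R (zero_cols A R C) A) = (R0, C0, Y1)"
      by (metis prod_cases3)
    have HK: "HK_output (set R) (set (zero_cols A R C)) A (R0, C0, Y1)"
      by (rule HK_correct_step[OF less.prems out])
    let ?R' = "filter (\<lambda>i. i \<notin> R0) R"
    have C': "set (live_cols A R C) = {j \<in> set C. \<exists>i\<in>set R. A i j \<noteq> -\<infinity>}"
      by (auto simp: live_cols_def)
    have CB: "set (zero_cols A R C)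
        = {j \<in> set (live_cols A R C). \<forall>i\<in>set R. A i j = 0 \<or> A i j = -\<infinity>}"
      by (auto simp: zero_cols_def)
    note sound = recursion_sound[OF finite_set finite_set C' CB HK]
    note complete = recursion_complete[OF finite_set finite_set C' CB HK]
    have sub: "R0 \<subseteq> set R" using HK_step_facts[OF less.prems out] by blast
    have R': "set ?R' = set R - R0" by auto
    have ne: "set R \<noteq> {}" using True by (simp add: reaches_HK_def)
    show ?thesis
    proof (cases "set R \<inter> R0 = {}")
      case True
      with sub have "R0 = {}" by blast
      with complete(1)[OF ne] show ?thesis
        by (auto simp: O_test_step(1)[where hk=hk, OF \<open>reaches_HK A R C\<close> out])
    next
      case False
      then have "length ?R' < length R" by (auto intro: length_filter_less)
      then have IH: "case fst (O_test hk A ?R' (live_cols A R C)) of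
          None \<Rightarrow> \<not> (\<exists>Y\<subseteq>set (live_cols A R C). vanishing_det (set R - R0) Y A)
        | Some Y \<Rightarrow> Y \<subseteq> set (live_cols A R C) \<and> vanishing_det (set R - R0) Y A"
        using less.hyps[of ?R' "live_cols A R C"] less.prems distinct_cols(1)[of C A R]
        unfolding R' by simp
      then show ?thesis
        using sound complete(2)[OF ne] False
        by (auto simp: O_test_step(1)[where hk=hk, OF \<open>reaches_HK A R C\<close> out] split: option.splits)
    qed
  qed
qed

section \<open>Number of operations\<close>

text \<open>
  The constant of a complexity assumption is replaced by its absolute value, which makes the bound
  monotone in the rank without an assumption on the sign.
\<close>

lemma HK_operations:
  assumes "HK_complexity K hk" "distinct R" "distinct C"
    "max_transversal (set R) (set (zero_cols A R C)) A \<le> D"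
  shows "real (snd (hk R (zero_cols A R C) A))
    \<le> \<bar>K\<bar> * (1 + sqrt (real (max 1 D)) * real (length R) * real (length (zero_cols A R C)))"
proof -
  let ?r = "max_transversal (set R) (set (zero_cols A R C)) A"
  let ?x = "1 + sqrt (real (max 1 ?r)) * real (length R) * real (length (zero_cols A R C))"
  have "real (snd (hk R (zero_cols A R C) A)) \<le> K * ?x"
    using assms(1-3) zero_cols_entries distinct_cols unfolding HK_complexity_def by metis
  also have "\<dots> \<le> \<bar>K\<bar> * ?x"
    by (intro mult_right_mono) auto
  also have "\<dots> \<le> \<bar>K\<bar> * (1 + sqrt (real (max 1 D)) * real (length R) * real (length (zero_cols A R C)))"
    using assms(4) by (intro mult_left_mono add_left_mono mult_right_mono) auto
  finally show ?thesis .
qed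

text \<open>
  The bound \<open>(20 + 2 \<bar>K\<bar>) d\<^sup>1\<^sup>/\<^sup>2 s n\<close> holds for every single call: \<open>2 + 6 + 4 + 8 = 20\<close> adds the
  coefficients of \<open>O_test_step\<close>, each of whose terms is at most \<open>s n\<close>, and \<open>2 \<bar>K\<bar>\<close> accounts for
  the subroutine with its constant cost. Summing over the calls multiplies by their number.
\<close>

lemma O_test_operations:
  assumes "HK_correct hk" "HK_complexity K hk" "s \<ge> 1" "n \<ge> 1"
    and "distinct R" "distinct C" "length R \<le> s" "length C \<le> n"
    and "\<forall>e\<in>set (HK_calls (O_test hk A R C)). HK_rank e \<le> D"
  shows "real (operations (O_test hk A R C)) \<le> real (main_calls (O_test hk A R C)) *
    ((20 + 2 * \<bar>K\<bar>) * (sqrt (real (max 1 D)) * real s * real n))"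
  using assms(5-)
proof (induction "length R" arbitrary: R C rule: less_induct)
  case less
  define q where "q = sqrt (real (max 1 D))"
  have q: "q \<ge> 1" by (simp add: q_def)
  have sn: "real s \<ge> 1" "real n \<ge> 1" using assms(3,4) by auto
  have "1 * 1 \<le> real s * real n" using sn by (intro mult_mono) auto
  then have sn1: "1 \<le> real s * real n" by simp
  have le_q: "real s * real n \<le> q * real s * real n"
    using mult_right_mono[OF q, of "real s * real n"] by (simp add: mult.assoc)
  have prod: "real (length R) * real (length C) \<le> real s * real n"
    using less.prems by (intro mult_mono) auto
  have ss: "real s \<le> real s * real n" "real n \<le> real s * real n"
    using sn by (auto simp: mult_le_cancel_left1 mult_le_cancel_right1)
  have ab: "real (length R) \<le> real s * real n" "real (length C) \<le> real s * real n"
    using less.prems(3,4) ss by linarith+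
  let ?c = "(20 + 2 * \<bar>K\<bar>) * (q * real s * real n)"
  have c_eq: "?c = 20 * (q * real s * real n) + 2 * (\<bar>K\<bar> * (q * real s * real n))"
    by (simp add: algebra_simps)
  have K0: "0 \<le> \<bar>K\<bar> * (q * real s * real n)" using q by simp
  show ?case unfolding q_def[symmetric]
  proof (cases "reaches_HK A R C")
    case False
    have "real (operations (O_test hk A R C)) \<le>
        real (1 + length R + length C + length R * (1 + 2 * length C))"
      using O_test_stop(4)[OF False] of_nat_le_iff by blast
    also have "\<dots> = 1 + 2 * real (length R) + real (length C) + 2 * (real (length R) * real (length C))"
      by (simp add: algebra_simps)
    also have "\<dots> \<le> ?c" unfolding c_eq using ab prod sn1 le_q K0 by linarith
    finally show "real (operations (O_test hk A R C)) \<le> real (main_calls (O_test hk A R C)) * ?c"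
      using O_test_stop(3)[OF False, of hk] by simp
  next
    case True
    obtain R0 C0 Y1 where out: "fst (hk R (zero_cols A R C) A) = (R0, C0, Y1)"
      by (metis prod_cases3)
    let ?m' = "O_test hk A (filter (\<lambda>i. i \<notin> R0) R) (live_cols A R C)"
    note step = O_test_step[where hk = hk, OF True out]
    have "max_transversal (set R) (set (zero_cols A R C)) A \<le> D"
      using less.prems(5) step(2) by simp
    from HK_operations[OF assms(2) less.prems(1,2) this]
    have "real (snd (hk R (zero_cols A R C) A))
        \<le> \<bar>K\<bar> * (1 + q * (real (length R) * real (length (zero_cols A R C))))"
      by (simp add: q_def mult.assoc)
    also have "\<dots> \<le> \<bar>K\<bar> * (q * (real s * real n) + q * (real s * real n))"
    proof (intro mult_left_mono add_mono)
      show "1 \<le> q * (real s * real n)" using sn1 le_q by (simp add: mult.assoc)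
      have "length (zero_cols A R C) \<le> n"
        using less.prems(4) by (auto simp: zero_cols_def live_cols_def intro: order_trans[OF length_filter_le])
      then show "real (length R) * real (length (zero_cols A R C)) \<le> real s * real n"
        using less.prems(3) by (intro mult_mono) auto
    qed (use q in auto)
    finally have hk: "real (snd (hk R (zero_cols A R C) A)) \<le> 2 * (\<bar>K\<bar> * (q * real s * real n))"
      by (simp add: algebra_simps)
    let ?rest = "if set R \<inter> R0 = {} then 0 else real (operations ?m')"
    have "real (operations (O_test hk A R C)) \<le> real (2 + 6 * length R + 4 * length C
        + 8 * length R * length C + snd (hk R (zero_cols A R C) A)
        + (if set R \<inter> R0 = {} then 0 else operations ?m'))"
      using step(4)[OF HK_step_facts(2)[OF assms(1) less.prems(1,2) out]] of_nat_le_iff by blast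
    also have "\<dots> = 2 + 6 * real (length R) + 4 * real (length C)
        + 8 * (real (length R) * real (length C)) + real (snd (hk R (zero_cols A R C) A)) + ?rest"
      by simp
    also have "\<dots> \<le> ?c + ?rest" unfolding c_eq using ab prod sn1 le_q hk by linarith
    finally have bound: "real (operations (O_test hk A R C)) \<le> ?c + ?rest" .
    show "real (operations (O_test hk A R C)) \<le> real (main_calls (O_test hk A R C)) * ?c"
    proof (cases "set R \<inter> R0 = {}")
      case True
      with bound step(3) show ?thesis by simp
    next
      case False
      then have "length (filter (\<lambda>i. i \<notin> R0) R) < length R" by (auto intro: length_filter_less)
      moreover have "length (live_cols A R C) \<le> n"
        using less.prems(4) by (auto simp: live_cols_def intro: order_trans[OF length_filter_le])
      moreover have "\<forall>e\<in>set (HK_calls ?m'). HK_rank e \<le> D"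
        using less.prems(5) step(2) False by auto
      ultimately have "real (operations ?m') \<le> real (main_calls ?m') * ?c"
        using less.hyps[of "filter (\<lambda>i. i \<notin> R0) R" "live_cols A R C"] less.prems distinct_cols
        unfolding q_def by auto
      then show ?thesis using bound step(3) False by (simp add: algebra_simps)
    qed
  qed
qed

section \<open>The variant with sorted columns\<close>

text \<open>
  The locale fixes the representation relation, which the assumption on the trees only asserts
  to exist.
\<close>

locale tree_storage =
  fixes K :: real and T :: "'t tree_sub" and rep :: "'t \<Rightarrow> ereal multiset \<Rightarrow> bool"
  assumes sort: "rep (fst (sort_column T xs)) (mset xs)"
    and sort_cost: "xs \<noteq> [] \<Longrightarrow> real (snd (sort_column T xs))
      \<le> K * (real (length xs) * (1 + ln (real (length xs))))"
    and delete: "rep t M \<Longrightarrow> x \<in># M \<Longrightarrow> rep (fst (delete_element T x t)) (M - {#x#})"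
    and delete_cost: "rep t M \<Longrightarrow> x \<in># M \<Longrightarrow>
      real (snd (delete_element T x t)) \<le> K * (1 + ln (real (size M)))"
    and greatest: "rep t M \<Longrightarrow> M \<noteq> {#} \<Longrightarrow> fst (greatest_element T t) = Max (set_mset M)"
    and greatest_cost: "rep t M \<Longrightarrow> M \<noteq> {#} \<Longrightarrow>
      real (snd (greatest_element T t)) \<le> K * (1 + ln (real (size M)))"

lemma balanced_trees_storage: "balanced_trees K T \<Longrightarrow> \<exists>rep. tree_storage K T rep"
proof -
  assume "balanced_trees K T"
  then obtain rep where rep:
    "\<forall>xs. rep (fst (sort_column T xs)) (mset xs) \<and> (xs \<noteq> [] \<longrightarrow>
      real (snd (sort_column T xs)) \<le> K * (real (length xs) * (1 + ln (real (length xs)))))"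
    "\<forall>t M x. rep t M \<and> x \<in># M \<longrightarrow> rep (fst (delete_element T x t)) (M - {#x#}) \<and>
      real (snd (delete_element T x t)) \<le> K * (1 + ln (real (size M)))"
    "\<forall>t M. rep t M \<and> M \<noteq> {#} \<longrightarrow> fst (greatest_element T t) = Max (set_mset M) \<and>
      real (snd (greatest_element T t)) \<le> K * (1 + ln (real (size M)))"
    unfolding balanced_trees_def by blast
  have "tree_storage K T rep"
    by unfold_locales (use rep in blast)+
  then show ?thesis by blast
qed

context tree_storage
begin

text \<open>
  The rows form a multiset so that deletion of rows is multiset difference, matching the
  specification of the trees.
\<close>

definition stores :: "entries \<Rightarrow> nat multiset \<Rightarrow> nat set \<Rightarrow> (nat \<Rightarrow> 't) \<Rightarrow> bool" where
  "stores A N C f \<longleftrightarrow> (\<forall>j\<in>C. rep (f j) (image_mset (\<lambda>i. A i j) N))"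

text \<open>
  A bound for one access to a tree with at most \<open>s\<close> elements; the absolute value makes it
  nonnegative.
\<close>

definition access_cost :: "nat \<Rightarrow> real" where
  "access_cost s = \<bar>K\<bar> * (1 + ln (real s))"

lemma access_cost_nonneg: "1 \<le> s \<Longrightarrow> 0 \<le> access_cost s"
  by (simp add: access_cost_def)

lemma access_cost_mono:
  assumes "1 \<le> k" "k \<le> s" "x \<le> K * (1 + ln (real k))"
  shows "x \<le> access_cost s"
proof -
  have "K * (1 + ln (real k)) \<le> \<bar>K\<bar> * (1 + ln (real k))"
    using assms(1) by (intro mult_right_mono) auto
  also have "\<dots> \<le> \<bar>K\<bar> * (1 + ln (real s))"
    using assms by (intro mult_left_mono) auto
  finally show ?thesis using assms(3) by (simp add: access_cost_def)
qed

lemma HK_calls_trees [simp]: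
  "HK_calls (sort_columns T A R C) = []" "HK_calls (delete_row T A i C f) = []"
  "HK_calls (delete_rows T A Rs C f) = []"
proof -
  show "HK_calls (sort_columns T A R C) = []" by (induction C) auto
  show row: "HK_calls (delete_row T A i C f) = []" for i f by (induction C arbitrary: f) auto
  show "HK_calls (delete_rows T A Rs C f) = []" by (induction Rs arbitrary: f) (auto simp: row)
qed

lemma sort_columns_stores: "stores A (mset R) (set C) (fst (sort_columns T A R C))"
proof (induction C)
  case (Cons j C)
  have "rep (fst (sort_column T (map (\<lambda>i. A i j) R))) (image_mset (\<lambda>i. A i j) (mset R))"
    using sort[of "map (\<lambda>i. A i j) R"] by simp
  with Cons show ?case by (auto simp: stores_def)
qed (simp add: stores_def)

lemma sort_columns_cost:
  assumes "R \<noteq> []"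
  shows "real (operations (sort_columns T A R C))
    \<le> real (length C) * (1 + real (length R) + real (length R) * access_cost (length R))"
proof (induction C)
  case (Cons j C)
  have "real (snd (sort_column T (map (\<lambda>i. A i j) R)))
      \<le> K * (real (length R) * (1 + ln (real (length R))))"
    using sort_cost[of "map (\<lambda>i. A i j) R"] assms by simp
  also have "\<dots> \<le> \<bar>K\<bar> * (real (length R) * (1 + ln (real (length R))))"
    using assms by (intro mult_right_mono mult_nonneg_nonneg add_nonneg_nonneg ln_ge_zero)
      (auto simp: Suc_le_eq)
  finally have "real (snd (sort_column T (map (\<lambda>i. A i j) R)))
      \<le> real (length R) * access_cost (length R)"
    by (simp add: access_cost_def algebra_simps)
  with Cons show ?case by (simp add: algebra_simps)
qed simp

lemma delete_row_outside: "j \<notin> set C \<Longrightarrow> fst (delete_row T A i C f) j = f j"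
  by (induction C arbitrary: f) auto

lemma delete_row_stores:
  assumes "distinct C" "stores A N (set C) f" "i \<in># N"
  shows "stores A (N - {#i#}) (set C) (fst (delete_row T A i C f))"
  using assms(1,2)
proof (induction C arbitrary: f)
  case (Cons j C)
  let ?f = "f(j := fst (delete_element T (A i j) (f j)))"
  have "rep (?f j) (image_mset (\<lambda>i. A i j) N - {#A i j#})"
    using Cons.prems(2) assms(3) by (simp add: stores_def delete)
  then have "rep (?f j) (image_mset (\<lambda>i. A i j) (N - {#i#}))"
    using assms(3) by (simp add: image_mset_Diff)
  moreover have "stores A N (set C) ?f" using Cons.prems by (auto simp: stores_def)
  with Cons have "stores A (N - {#i#}) (set C) (fst (delete_row T A i C ?f))" by simp
  moreover have "fst (delete_row T A i C ?f) j = ?f j"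
    using Cons.prems(1) by (intro delete_row_outside) simp
  ultimately show ?case by (simp add: stores_def)
qed (simp add: stores_def)

lemma delete_row_cost:
  assumes "distinct C" "stores A N (set C) f" "i \<in># N" "size N \<le> s"
  shows "real (operations (delete_row T A i C f)) \<le> real (length C) * (1 + access_cost s)"
  using assms(1,2)
proof (induction C arbitrary: f)
  case (Cons j C)
  let ?f = "f(j := fst (delete_element T (A i j) (f j)))"
  have "N \<noteq> {#}" using assms(3) by auto
  then have "1 \<le> size N" by (simp add: Suc_le_eq nonempty_has_size)
  moreover have "real (snd (delete_element T (A i j) (f j))) \<le> K * (1 + ln (real (size N)))"
    using Cons.prems(2) assms(3) delete_cost[of "f j" "image_mset (\<lambda>i. A i j) N" "A i j"]
    by (simp add: stores_def)
  ultimately have "real (snd (delete_element T (A i j) (f j))) \<le> access_cost s"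
    using assms(4) access_cost_mono by blast
  moreover have "stores A N (set C) ?f" using Cons.prems by (auto simp: stores_def)
  with Cons have "real (operations (delete_row T A i C ?f)) \<le> real (length C) * (1 + access_cost s)"
    by simp
  ultimately show ?case by (simp add: algebra_simps)
qed simp

lemma delete_rows_stores:
  assumes "distinct C" "stores A N (set C) f" "mset Rs \<subseteq># N"
  shows "stores A (N - mset Rs) (set C) (fst (delete_rows T A Rs C f))"
  using assms(2,3)
proof (induction Rs arbitrary: N f)
  case (Cons i Rs)
  have i: "i \<in># N" and sub: "mset Rs \<subseteq># N - {#i#}"
    using Cons.prems(2) by (auto simp: insert_subset_eq_iff)
  show ?case
    using Cons.IH[OF delete_row_stores[OF assms(1) Cons.prems(1) i] sub] by simp
qed simp

lemma delete_rows_cost: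
  assumes "distinct C" "stores A N (set C) f" "mset Rs \<subseteq># N" "size N \<le> s"
  shows "real (operations (delete_rows T A Rs C f))
    \<le> real (length Rs) * (1 + real (length C) * (1 + access_cost s))"
  using assms(2-)
proof (induction Rs arbitrary: N f)
  case (Cons i Rs)
  have i: "i \<in># N" and sub: "mset Rs \<subseteq># N - {#i#}"
    using Cons.prems(2) by (auto simp: insert_subset_eq_iff)
  have "size (N - {#i#}) \<le> s" using Cons.prems(3) i by (simp add: size_Diff_singleton)
  with Cons.IH[OF delete_row_stores[OF assms(1) Cons.prems(1) i] sub]
    delete_row_cost[OF assms(1) Cons.prems(1) i Cons.prems(3)]
  show ?case by (simp add: algebra_simps)
qed simp

lemma greatest_entry:
  assumes "stores A (mset R) (set C) f" "j \<in> set C" "R \<noteq> []"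
  shows "fst (greatest_element T (f j)) = Max ((\<lambda>i. A i j) ` set R)"
  using assms greatest[of "f j" "image_mset (\<lambda>i. A i j) (mset R)"] by (simp add: stores_def)

lemma greatest_entry_cost:
  assumes "stores A (mset R) (set C) f" "j \<in> set C" "R \<noteq> []" "length R \<le> s"
  shows "real (snd (greatest_element T (f j))) \<le> access_cost s"
  using assms greatest_cost[of "f j" "image_mset (\<lambda>i. A i j) (mset R)"]
  by (intro access_cost_mono[of "length R"]) (auto simp: stores_def Suc_le_eq)

lemma live_cols_by_trees:
  assumes "stores A (mset R) (set C) f" "R \<noteq> []"
  shows "filter (\<lambda>j. fst (greatest_element T (f j)) \<noteq> -\<infinity>) C = live_cols A R C"
  unfolding live_cols_def
proof (rule filter_cong[OF refl])
  fix j assume "j \<in> set C"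
  have "Max ((\<lambda>i. A i j) ` set R) = -\<infinity> \<longleftrightarrow> Max ((\<lambda>i. A i j) ` set R) \<le> -\<infinity>" by simp
  also have "\<dots> \<longleftrightarrow> (\<forall>i\<in>set R. A i j \<le> -\<infinity>)" using assms(2) by (subst Max_le_iff) auto
  finally show "(fst (greatest_element T (f j)) \<noteq> -\<infinity>) = (\<exists>i\<in>set R. A i j \<noteq> -\<infinity>)"
    using greatest_entry[OF assms(1) \<open>j \<in> set C\<close> assms(2)] by simp
qed

lemma zero_cols_by_trees:
  assumes "stores A (mset R) (set C) f" "R \<noteq> []" "entries_in nat_minf (set R) (set C) A"
  shows "filter (\<lambda>j. fst (greatest_element T (f j)) \<le> 0) (live_cols A R C) = zero_cols A R C"
  unfolding zero_cols_def
proof (rule filter_cong[OF refl])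
  fix j assume "j \<in> set (live_cols A R C)"
  then have j: "j \<in> set C" using zero_cols_sub(2) by blast
  have "Max ((\<lambda>i. A i j) ` set R) \<le> 0 \<longleftrightarrow> (\<forall>i\<in>set R. A i j \<le> 0)"
    using assms(2) by (subst Max_le_iff) auto
  also have "\<dots> \<longleftrightarrow> (\<forall>i\<in>set R. A i j = 0 \<or> A i j = -\<infinity>)"
  proof (rule ball_cong[OF refl])
    fix i assume "i \<in> set R"
    with assms(3) j have "A i j \<in> nat_minf" by (simp add: entries_in_def)
    from nat_minfD[OF this] show "A i j \<le> 0 \<longleftrightarrow> A i j = 0 \<or> A i j = -\<infinity>" by auto
  qed
  finally show "(fst (greatest_element T (f j)) \<le> 0) = (\<forall>i\<in>set R. A i j = 0 \<or> A i j = -\<infinity>)"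
    using greatest_entry[OF assms(1) j assms(2)] by simp
qed

text \<open>
  The unfolding of one call of the variant parallels that of the main algorithm. The table \<open>Z\<close>
  stays valid because a zero prevents its column from being dropped.
\<close>

lemma O_test_trees_rec_stop:
  assumes stop: "\<not> reaches_HK A R C" and Z: "\<forall>i\<in>set R. i \<in> set Z \<longleftrightarrow> (\<exists>j\<in>set C. A i j = 0)"
  shows "fst (O_test_trees_rec hk T A Z R C f) = (if R = [] then Some {} else None)"
    "HK_calls (O_test_trees_rec hk T A Z R C f) = []"
    "operations (O_test_trees_rec hk T A Z R C f) \<le> 1 + 3 * length R + length C"
proof -
  have *: "length R > length C \<or> R = [] \<or> (\<exists>i\<in>set R. i \<notin> set Z)"
    using assms by (auto simp: reaches_HK_def)
  then show "fst (O_test_trees_rec hk T A Z R C f) = (if R = [] then Some {} else None)"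
    "HK_calls (O_test_trees_rec hk T A Z R C f) = []"
    by (auto simp: O_test_trees_rec.simps[of hk T A Z R C f])
  have "operations (exists_run (\<lambda>i. do { b \<leftarrow> member_run (set Z) i; return (\<not> b) }) R) \<le> length R * 2"
    using operations_exists_run[of R "\<lambda>i. do { b \<leftarrow> member_run (set Z) i; return (\<not> b) }" 1] by simp
  with * show "operations (O_test_trees_rec hk T A Z R C f) \<le> 1 + 3 * length R + length C"
    by (auto simp: O_test_trees_rec.simps[of hk T A Z R C f])
qed

lemma O_test_trees_rec_step:
  fixes A :: entries
  assumes reach: "reaches_HK A R C" and Z: "\<forall>i\<in>set R. i \<in> set Z \<longleftrightarrow> (\<exists>j\<in>set C. A i j = 0)"
    and stores: "stores A (mset R) (set C) f" and entries: "entries_in nat_minf (set R) (set C) A"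
    and dist: "distinct C"
    and out: "fst (hk R (zero_cols A R C) A) = (R0, C0, Y1)"
  defines "call \<equiv> HK_Call R (zero_cols A R C) A (R0, C0, Y1) (snd (hk R (zero_cols A R C) A))"
    and "R' \<equiv> filter (\<lambda>i. i \<notin> R0) R" and "Rs \<equiv> filter (\<lambda>i. i \<in> R0) R"
    and "C' \<equiv> live_cols A R C"
  defines "f' \<equiv> fst (delete_rows T A Rs C' f)"
  defines "m' \<equiv> O_test_trees_rec hk T A Z R' C' f'"
  shows "fst (O_test_trees_rec hk T A Z R C f) =
      (if set R \<inter> R0 = {} then None else map_option (\<lambda>Y2. Y2 \<union> Y1) (fst m'))"
    "HK_calls (O_test_trees_rec hk T A Z R C f) =
      call # (if set R \<inter> R0 = {} then [] else HK_calls m')"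
    "stores A (mset R') (set C') f'"
    "\<forall>i\<in>set R'. i \<in> set Z \<longleftrightarrow> (\<exists>j\<in>set C'. A i j = 0)"
    "card Y1 \<le> length C \<Longrightarrow> length R \<le> s \<Longrightarrow> real (operations (O_test_trees_rec hk T A Z R C f)) \<le>
      2 + 7 * real (length R) + 2 * real (length C) + 2 * (real (length C) * (1 + access_cost s))
        + real (length R) * real (length (zero_cols A R C)) + real (snd (hk R (zero_cols A R C) A))
        + real (length Rs) * (1 + real (length C) * (1 + access_cost s))
        + (if set R \<inter> R0 = {} then 0 else real (operations m'))"
proof -
  have cond: "\<not> length C < length R" "R \<noteq> []" "\<not> (\<exists>i\<in>set R. i \<notin> set Z)"
    using reach Z by (auto simp: reaches_HK_def)
  have empty: "filter (\<lambda>i. i \<in> R0) R = [] \<longleftrightarrow> set R \<inter> R0 = {}"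
    by (auto simp: filter_empty_conv)
  have sub: "set C' \<subseteq> set C" by (auto simp: C'_def live_cols_def)
  have stores': "stores A (mset R) (set C') f" using stores sub by (auto simp: stores_def)
  note unfold = O_test_trees_rec.simps[of hk T A Z R C f] cond empty out copy_submatrix_def
    live_cols_by_trees[OF stores cond(2)] zero_cols_by_trees[OF stores cond(2) entries]
  show "fst (O_test_trees_rec hk T A Z R C f) =
      (if set R \<inter> R0 = {} then None else map_option (\<lambda>Y2. Y2 \<union> Y1) (fst m'))"
    unfolding m'_def f'_def R'_def Rs_def C'_def by (auto simp: unfold split: option.splits)
  show "HK_calls (O_test_trees_rec hk T A Z R C f) =
      call # (if set R \<inter> R0 = {} then [] else HK_calls m')"
    unfolding m'_def f'_def R'_def Rs_def C'_def call_def by (auto simp: unfold split: option.splits)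
  have part: "mset R = mset Rs + mset R'"
    unfolding Rs_def R'_def using multiset_partition[of "mset R" "\<lambda>i. i \<in> R0"] by simp
  have "distinct C'" using dist by (simp add: C'_def distinct_cols)
  note deletion = this stores'
  have le: "mset Rs \<subseteq># mset R" using part by simp
  show "stores A (mset R') (set C') f'"
    using delete_rows_stores[OF deletion le] part by (simp add: f'_def)
  show "\<forall>i\<in>set R'. i \<in> set Z \<longleftrightarrow> (\<exists>j\<in>set C'. A i j = 0)"
  proof
    fix i assume "i \<in> set R'"
    then have i: "i \<in> set R" by (simp add: R'_def)
    have "(\<exists>j\<in>set C. A i j = 0) \<longleftrightarrow> (\<exists>j\<in>set C'. A i j = 0)"
    proof
      assume "\<exists>j\<in>set C. A i j = 0"
      then obtain j where "j \<in> set C" "A i j = 0" by blast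
      moreover from this i have "j \<in> set C'"
        by (auto simp: C'_def live_cols_def intro!: bexI[of _ i])
      ultimately show "\<exists>j\<in>set C'. A i j = 0" by blast
    qed (use sub in blast)
    with Z i show "i \<in> set Z \<longleftrightarrow> (\<exists>j\<in>set C'. A i j = 0)" by simp
  qed
  assume Y1: "card Y1 \<le> length C" and s: "length R \<le> s"
  have g: "0 \<le> access_cost s" using s cond(2) access_cost_nonneg[of s] by (cases R) auto
  have lenC': "length C' \<le> length C" by (simp add: C'_def live_cols_def)
  have c1: "real (operations (exists_run (\<lambda>i. do { b \<leftarrow> member_run (set Z) i; return (\<not> b) }) R))
      \<le> 2 * real (length R)"
    using operations_exists_run[of R "\<lambda>i. do { b \<leftarrow> member_run (set Z) i; return (\<not> b) }" 1] by simp
  have c2: "real (operations (filter_run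
        (\<lambda>j. do { m \<leftarrow> run_sub (greatest_element T (f j)); return (m \<noteq> -\<infinity>) }) C))
      \<le> real (length C) * (1 + access_cost s)"
    by (rule operations_filter_run) (simp add: greatest_entry_cost[OF stores _ cond(2) s])
  have "real (operations (filter_run
        (\<lambda>j. do { m \<leftarrow> run_sub (greatest_element T (f j)); return (m \<le> 0) }) C'))
      \<le> real (length C') * (1 + access_cost s)"
    by (rule operations_filter_run) (simp add: greatest_entry_cost[OF stores' _ cond(2) s])
  also have "\<dots> \<le> real (length C) * (1 + access_cost s)"
    using lenC' g by (intro mult_right_mono) auto
  finally have c3: "real (operations (filter_run
        (\<lambda>j. do { m \<leftarrow> run_sub (greatest_element T (f j)); return (m \<le> 0) }) C'))
      \<le> real (length C) * (1 + access_cost s)" .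
  have c5: "real (operations (filter_run (member_run R0) R)) \<le> 2 * real (length R)"
    using operations_filter_run[of R "member_run R0" 1] by simp
  have c6: "real (operations (filter_run (\<lambda>i. do { b \<leftarrow> member_run R0 i; return (\<not> b) }) R))
      \<le> 2 * real (length R)"
    using operations_filter_run[of R "\<lambda>i. do { b \<leftarrow> member_run R0 i; return (\<not> b) }" 1] by simp
  have "real (operations (delete_rows T A Rs C' f))
      \<le> real (length Rs) * (1 + real (length C') * (1 + access_cost s))"
    using delete_rows_cost[OF deletion le] s by simp
  also have "\<dots> \<le> real (length Rs) * (1 + real (length C) * (1 + access_cost s))"
    using lenC' g by (intro mult_left_mono add_left_mono mult_right_mono) auto
  finally have c7: "real (operations (delete_rows T A Rs C' f))
      \<le> real (length Rs) * (1 + real (length C) * (1 + access_cost s))" .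
  have pos: "0 \<le> real (length Rs) * (1 + real (length C) * (1 + access_cost s))"
    using g by simp
  have "real (operations (O_test_trees_rec hk T A Z R C f)) = 1 + (real (length R) + real (length C)) +
      real (operations (exists_run (\<lambda>i. do { b \<leftarrow> member_run (set Z) i; return (\<not> b) }) R)) +
      real (operations (filter_run
        (\<lambda>j. do { m \<leftarrow> run_sub (greatest_element T (f j)); return (m \<noteq> -\<infinity>) }) C)) +
      real (operations (filter_run
        (\<lambda>j. do { m \<leftarrow> run_sub (greatest_element T (f j)); return (m \<le> 0) }) C')) +
      real (length R) * real (length (zero_cols A R C)) + real (snd (hk R (zero_cols A R C) A)) +
      real (operations (filter_run (member_run R0) R)) +
      (if set R \<inter> R0 = {} then 0 else
        real (operations (filter_run (\<lambda>i. do { b \<leftarrow> member_run R0 i; return (\<not> b) }) R)) +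
        real (operations (delete_rows T A Rs C' f)) + real (operations m') +
        (if fst m' = None then 0 else 1 + real (card Y1)))"
    unfolding m'_def f'_def R'_def Rs_def C'_def by (auto simp: unfold split: option.splits)
  also have "\<dots> \<le> 2 + 7 * real (length R) + 2 * real (length C)
        + 2 * (real (length C) * (1 + access_cost s))
        + real (length R) * real (length (zero_cols A R C)) + real (snd (hk R (zero_cols A R C) A))
        + real (length Rs) * (1 + real (length C) * (1 + access_cost s))
        + (if set R \<inter> R0 = {} then 0 else real (operations m'))"
    using c1 c2 c3 c5 c6 c7 pos Y1 by (auto split: if_splits)
  finally show "real (operations (O_test_trees_rec hk T A Z R C f)) \<le>
      2 + 7 * real (length R) + 2 * real (length C) + 2 * (real (length C) * (1 + access_cost s))
        + real (length R) * real (length (zero_cols A R C)) + real (snd (hk R (zero_cols A R C) A))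
        + real (length Rs) * (1 + real (length C) * (1 + access_cost s))
        + (if set R \<inter> R0 = {} then 0 else real (operations m'))" .
qed

lemma O_test_trees_rec_agrees:
  assumes "\<forall>i\<in>set R. i \<in> set Z \<longleftrightarrow> (\<exists>j\<in>set C. A i j = 0)"
    and "stores A (mset R) (set C) f" "entries_in nat_minf (set R) (set C) A" "distinct C"
  shows "fst (O_test_trees_rec hk T A Z R C f) = fst (O_test hk A R C) \<and>
    HK_calls (O_test_trees_rec hk T A Z R C f) = HK_calls (O_test hk A R C)"
  using assms
proof (induction "length R" arbitrary: R C f rule: less_induct)
  case less
  show ?case
  proof (cases "reaches_HK A R C")
    case False
    then show ?thesis using O_test_stop[OF False] O_test_trees_rec_stop[OF False less.prems(1)] by simp
  next
    case True
    obtain R0 C0 Y1 where out: "fst (hk R (zero_cols A R C) A) = (R0, C0, Y1)"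
      by (metis prod_cases3)
    note step = O_test_step[where hk = hk, OF True out]
    note step' = O_test_trees_rec_step[where hk = hk, OF True less.prems out]
    show ?thesis
    proof (cases "set R \<inter> R0 = {}")
      case True
      with step(1,2) step'(1,2) show ?thesis by simp
    next
      case False
      have "length (filter (\<lambda>i. i \<notin> R0) R) < length R"
        using False by (auto intro: length_filter_less)
      moreover have "entries_in nat_minf (set (filter (\<lambda>i. i \<notin> R0) R)) (set (live_cols A R C)) A"
        using less.prems(3) zero_cols_sub(2)[of A R C] by (auto simp: entries_in_def)
      ultimately show ?thesis
        using less.hyps[OF _ step'(4) step'(3)] less.prems(4) distinct_cols(1)[of C A R]
          step(1,2) step'(1,2) by simp
    qed
  qed
qed

text \<open>
  If the cover uses no column, the columns given to the subroutine have their zeros in the rows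
  \<open>R0\<close> only. After suppression of these rows nothing but \<open>-\<infinity>\<close> is left in them.
\<close>

lemma zero_cols_vanish:
  assumes HK: "HK_output (set R) (set (zero_cols A R C)) A (R0, {}, Y1)"
  shows "length (live_cols A (filter (\<lambda>i. i \<notin> R0) R) (live_cols A R C)) + length (zero_cols A R C)
    \<le> length (live_cols A R C)"
proof -
  let ?Q = "\<lambda>j. \<forall>i\<in>set R. A i j = 0 \<or> A i j = -\<infinity>"
  let ?P = "\<lambda>j. \<exists>i\<in>set (filter (\<lambda>i. i \<notin> R0) R). A i j \<noteq> -\<infinity>"
  have excl: "\<not> ?Q j" if j: "j \<in> set (live_cols A R C)" "?P j" for j
  proof
    assume "?Q j"
    with j(1) have "j \<in> set (zero_cols A R C)" by (simp add: zero_cols_def)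
    with HK_outputD(4)[OF HK] \<open>?Q j\<close> j(2) show False by auto
  qed
  have "filter ?P (live_cols A R C) = filter ?P (filter (\<lambda>j. \<not> ?Q j) (live_cols A R C))"
    using excl by (auto intro!: filter_cong)
  then have "length (filter ?P (live_cols A R C)) = length (filter ?P (filter (\<lambda>j. \<not> ?Q j) (live_cols A R C)))"
    by (rule arg_cong)
  also have "\<dots> \<le> length (filter (\<lambda>j. \<not> ?Q j) (live_cols A R C))"
    by (rule length_filter_le)
  finally have "length (filter ?P (live_cols A R C)) \<le> length (filter (\<lambda>j. \<not> ?Q j) (live_cols A R C))" .
  then show ?thesis
    using sum_length_filter_compl[of ?Q "live_cols A R C"]
    unfolding zero_cols_def live_cols_def[of A "filter (\<lambda>i. i \<notin> R0) R"] by linarith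
qed

text \<open>
  The potential has three parts. The first pays for a call that does not reach the subroutine. The second provides
  \<open>O(n (1 + ln s))\<close> for each remaining row; a call that recurses suppresses at least one row and
  pays its tree accesses and its constant overhead from the rows it suppresses. The third provides
  \<open>O(d\<^sup>1\<^sup>/\<^sup>2 s)\<close> for each live column, and the columns given to the subroutine, which are no longer
  live in the recursive call, pay for its run.
\<close>

lemma O_test_trees_rec_operations:
  assumes hk: "HK_correct hk" "HK_complexity K hk" and sn: "s \<ge> 1" "n \<ge> 1"
    and "\<forall>i\<in>set R. i \<in> set Z \<longleftrightarrow> (\<exists>j\<in>set C. A i j = 0)"
    and "stores A (mset R) (set C) f" "entries_in nat_minf (set R) (set C) A"
    and "distinct C" "distinct R" "length R \<le> s" "length C \<le> n"
    and "\<forall>e\<in>set (HK_calls (O_test_trees_rec hk T A Z R C f)). HK_rank e \<le> D"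
    and "\<forall>R' C' B R0 C0 Y1 k.
      HK_Call R' C' B (R0, C0, Y1) k \<in> set (HK_calls (O_test_trees_rec hk T A Z R C f)) \<longrightarrow> C0 = {}"
  shows "real (operations (O_test_trees_rec hk T A Z R C f)) \<le> 5 * (real s * real n)
    + (15 + 4 * \<bar>K\<bar>) * (real n * (1 + ln (real s))) * real (length R)
    + (1 + \<bar>K\<bar>) * (sqrt (real (max 1 D)) * real s) * real (length (live_cols A R C))"
  using assms(5-)
proof (induction "length R" arbitrary: R C f rule: less_induct)
  case less
  define q where "q = sqrt (real (max 1 D))"
  define L where "L = 1 + ln (real s)"
  define X where "X = real n * L"
  define k where "k = \<bar>K\<bar>"
  have q: "q \<ge> 1" by (simp add: q_def)
  have L: "L \<ge> 1" using sn by (simp add: L_def)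
  have k: "k \<ge> 0" by (simp add: k_def)
  have nX: "real n \<le> X" using L sn(2) by (simp add: X_def mult_le_cancel_left1)
  have X1: "1 \<le> X" using nX sn(2) by simp
  have g: "access_cost s = k * L" by (simp add: access_cost_def k_def L_def)
  show ?case unfolding q_def[symmetric] L_def[symmetric] X_def[symmetric] k_def[symmetric]
  proof (cases "reaches_HK A R C")
    case False
    have "real (operations (O_test_trees_rec hk T A Z R C f)) \<le> real (1 + 3 * length R + length C)"
      using O_test_trees_rec_stop(3)[OF False less.prems(1)] of_nat_le_iff by blast
    also have "\<dots> \<le> 1 + 3 * real s + real n" using less.prems(6,7) by simp
    also have "\<dots> \<le> 5 * (real s * real n)"
    proof -
      have "1 \<le> real s" "1 \<le> real n" using sn by auto
      then have "real s \<le> real s * real n" "real n \<le> real s * real n"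
        by (auto simp: mult_le_cancel_left1 mult_le_cancel_right1)
      with \<open>1 \<le> real s\<close> show ?thesis by linarith
    qed
    also have "\<dots> \<le> 5 * (real s * real n) + (15 + 4 * k) * X * real (length R)
        + (1 + k) * (q * real s) * real (length (live_cols A R C))"
      using k X1 q by simp
    finally show "real (operations (O_test_trees_rec hk T A Z R C f)) \<le> 5 * (real s * real n)
        + (15 + 4 * k) * X * real (length R)
        + (1 + k) * (q * real s) * real (length (live_cols A R C))" .
  next
    case True
    obtain R0 C0 Y1 where out: "fst (hk R (zero_cols A R C) A) = (R0, C0, Y1)"
      by (metis prod_cases3)
    note step = O_test_trees_rec_step[where hk = hk, OF True less.prems(1-4) out]
    define R' where "R' = filter (\<lambda>i. i \<notin> R0) R"
    define Rs where "Rs = filter (\<lambda>i. i \<in> R0) R"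
    define C' where "C' = live_cols A R C"
    define CB where "CB = zero_cols A R C"
    define m' where "m' = O_test_trees_rec hk T A Z R' C' (fst (delete_rows T A Rs C' f))"
    note step = step[folded R'_def Rs_def C'_def CB_def, folded m'_def]
    have "HK_Call R CB A (R0, C0, Y1) (snd (hk R CB A))
        \<in> set (HK_calls (O_test_trees_rec hk T A Z R C f))"
      unfolding step(2) by simp
    then have "C0 = {}" using less.prems(9) by blast
    have HK: "HK_output (set R) (set CB) A (R0, {}, Y1)"
      using HK_correct_step[OF hk(1) less.prems(5,4) out] unfolding \<open>C0 = {}\<close> CB_def .
    have Y1: "card Y1 \<le> length C" using HK_step_facts(2)[OF hk(1) less.prems(5,4) out] .
    have rank: "max_transversal (set R) (set CB) A \<le> D"
      using less.prems(8) step(2) by simp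
    have ab: "1 \<le> length R" "length R \<le> length C" using True by (auto simp: reaches_HK_def Suc_le_eq)
    then have aX: "real (length R) \<le> X" "real (length C) \<le> X"
      using nX less.prems(7) by linarith+
    have aCB: "real (length R) * real (length CB) \<le> q * real s * real (length CB)"
    proof (rule mult_right_mono)
      have "real (length R) \<le> real s" using less.prems(6) by simp
      also have "\<dots> \<le> q * real s" using q by (simp add: mult_le_cancel_right1)
      finally show "real (length R) \<le> q * real s" .
    qed simp
    have "real (snd (hk R CB A)) \<le> k * (1 + q * real (length R) * real (length CB))"
      using HK_operations[OF hk(2) less.prems(5,4) rank[unfolded CB_def]]
      by (simp add: q_def k_def CB_def)
    also have "\<dots> \<le> k * (X + q * real s * real (length CB))"
      using k q X1 less.prems(6) by (intro mult_left_mono add_mono mult_right_mono) auto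
    finally have c_hk: "real (snd (hk R CB A)) \<le> k * X + k * (q * real s * real (length CB))"
      by (simp add: algebra_simps)
    have acc: "real (length C) * (1 + access_cost s) \<le> X + k * X"
    proof -
      have "real (length C) * (1 + access_cost s) \<le> real n * (1 + k * L)"
        using less.prems(7) k L by (simp add: g mult_right_mono)
      also have "\<dots> \<le> X + k * X" using nX by (simp add: X_def algebra_simps)
      finally show ?thesis .
    qed
    have c_del: "real (length Rs) * (1 + real (length C) * (1 + access_cost s))
        \<le> real (length Rs) * (2 * X + k * X)"
      using acc X1 by (intro mult_left_mono) auto
    let ?rest = "if set R \<inter> R0 = {} then 0 else real (operations m')"
    have "real (operations (O_test_trees_rec hk T A Z R C f)) \<le>
        2 + 7 * real (length R) + 2 * real (length C) + 2 * (real (length C) * (1 + access_cost s))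
        + real (length R) * real (length CB) + real (snd (hk R CB A))
        + real (length Rs) * (1 + real (length C) * (1 + access_cost s)) + ?rest"
      using step(5)[OF Y1 less.prems(6)] .
    also have "\<dots> \<le> 13 * X + 3 * (k * X) + (q * real s * real (length CB)
        + k * (q * real s * real (length CB))) + real (length Rs) * (2 * X + k * X) + ?rest"
      using c_hk c_del acc aCB aX X1 by linarith
    also have "\<dots> = (13 + 3 * k) * X + (1 + k) * (q * real s) * real (length CB)
        + (2 + k) * X * real (length Rs) + ?rest"
      by (simp add: algebra_simps)
    finally have bound: "real (operations (O_test_trees_rec hk T A Z R C f)) \<le>
        (13 + 3 * k) * X + (1 + k) * (q * real s) * real (length CB)
        + (2 + k) * X * real (length Rs) + ?rest" .
    have W: "0 \<le> (1 + k) * (q * real s)" using k q by simp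
    have split: "length R = length Rs + length R'"
      unfolding Rs_def R'_def using sum_length_filter_compl[of "\<lambda>i. i \<in> R0" R] by simp
    show "real (operations (O_test_trees_rec hk T A Z R C f)) \<le> 5 * (real s * real n)
        + (15 + 4 * k) * X * real (length R)
        + (1 + k) * (q * real s) * real (length (live_cols A R C))"
    proof (cases "set R \<inter> R0 = {}")
      case True
      (* The call fails after HK. It has at least one row, whose share pays the overhead. *)
      then have "Rs = []" by (auto simp: Rs_def filter_empty_conv)
      have "(13 + 3 * k) * X * 1 \<le> (15 + 4 * k) * X * real (length R)"
        using k X1 ab by (intro mult_mono) auto
      moreover have "(1 + k) * (q * real s) * real (length CB)
          \<le> (1 + k) * (q * real s) * real (length (live_cols A R C))"
        using W by (intro mult_left_mono) (auto simp: CB_def zero_cols_def)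
      moreover have "0 \<le> real s * real n" by simp
      moreover have "real (operations (O_test_trees_rec hk T A Z R C f))
          \<le> (13 + 3 * k) * X * 1 + (1 + k) * (q * real s) * real (length CB)"
        using bound True \<open>Rs = []\<close> by simp
      ultimately show ?thesis by linarith
    next
      case False
      then have "Rs \<noteq> []" by (auto simp: Rs_def filter_empty_conv)
      then have Rs1: "1 \<le> length Rs" by (simp add: Suc_le_eq)
      have "length R' < length R" using split Rs1 by linarith
      moreover have "entries_in nat_minf (set R') (set C') A"
        using less.prems(3) zero_cols_sub(2)[of A R C] by (auto simp: entries_in_def R'_def C'_def)
      moreover have "distinct C'" "distinct R'" "length R' \<le> s" "length C' \<le> n"
        using less.prems(4-7) split
        by (auto simp: C'_def R'_def live_cols_def intro: order_trans[OF length_filter_le])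
      moreover have "\<forall>e\<in>set (HK_calls m'). HK_rank e \<le> D"
        "\<forall>R' C' B R0 C0 Y1 k. HK_Call R' C' B (R0, C0, Y1) k \<in> set (HK_calls m') \<longrightarrow> C0 = {}"
        using less.prems(8,9) False unfolding step(2) by auto
      ultimately have IH: "real (operations m') \<le> 5 * (real s * real n)
          + (15 + 4 * k) * X * real (length R')
          + (1 + k) * (q * real s) * real (length (live_cols A R' C'))"
        using less.hyps[of R' C' "fst (delete_rows T A Rs C' f)"] step(3,4)
        unfolding q_def L_def X_def k_def m'_def by simp
      have "(13 + 3 * k) * X * 1 \<le> (13 + 3 * k) * X * real (length Rs)"
        using k X1 Rs1 by (intro mult_left_mono) auto
      then have "(13 + 3 * k) * X + (2 + k) * X * real (length Rs) + (15 + 4 * k) * X * real (length R')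
          \<le> (15 + 4 * k) * X * real (length R)"
        unfolding split by (simp add: algebra_simps)
      moreover have "(1 + k) * (q * real s) * (real (length (live_cols A R' C')) + real (length CB))
          \<le> (1 + k) * (q * real s) * real (length (live_cols A R C))"
        using zero_cols_vanish[OF HK[unfolded CB_def]] W
        by (intro mult_left_mono) (auto simp: R'_def C'_def CB_def)
      ultimately show ?thesis using bound IH False by (simp add: distrib_left)
    qed
  qed
qed

lemma O_test_trees_agrees:
  assumes "entries_in nat_minf (set R) (set C) A" "distinct C"
  shows "fst (O_test_trees hk T A R C) = fst (O_test hk A R C)"
    "HK_calls (O_test_trees hk T A R C) = HK_calls (O_test hk A R C)"
proof -
  let ?Z = "filter (\<lambda>i. \<exists>j\<in>set C. A i j = 0) R"
  have "\<forall>i\<in>set R. i \<in> set ?Z \<longleftrightarrow> (\<exists>j\<in>set C. A i j = 0)" by simp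
  from O_test_trees_rec_agrees[OF this sort_columns_stores assms, of hk]
  show "fst (O_test_trees hk T A R C) = fst (O_test hk A R C)"
    "HK_calls (O_test_trees hk T A R C) = HK_calls (O_test hk A R C)"
    by (simp_all add: O_test_trees_def)
qed

text \<open>
  The preparation adds \<open>O(s n (1 + ln s))\<close> to the potential of the initial call. The terms without
  logarithm are absorbed by the square root, which is at least 1.
\<close>

lemma O_test_trees_operations:
  assumes "HK_correct hk" "HK_complexity K hk" "R \<noteq> []" "C \<noteq> []"
    and "entries_in nat_minf (set R) (set C) A" "distinct C" "distinct R"
    and "\<forall>e\<in>set (HK_calls (O_test_trees hk T A R C)). HK_rank e \<le> D"
    and "\<forall>R' C' B R0 C0 Y1 k.
      HK_Call R' C' B (R0, C0, Y1) k \<in> set (HK_calls (O_test_trees hk T A R C)) \<longrightarrow> C0 = {}"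
  shows "real (operations (O_test_trees hk T A R C)) \<le> (26 + 6 * \<bar>K\<bar>) *
    ((sqrt (real (max 1 D)) + ln (real (length R))) * real (length R) * real (length C))"
proof -
  define s n k q L where "s = real (length R)" and "n = real (length C)" and "k = \<bar>K\<bar>"
    and "q = sqrt (real (max 1 D))" and "L = 1 + ln (real (length R))"
  have sn: "1 \<le> s" "1 \<le> n" using assms(3,4) by (auto simp: s_def n_def Suc_le_eq)
  have k: "0 \<le> k" and q: "1 \<le> q" by (auto simp: k_def q_def)
  have L: "1 \<le> L" using sn(1) by (simp add: L_def s_def)
  let ?Z = "filter (\<lambda>i. \<exists>j\<in>set C. A i j = 0) R"
  let ?f = "fst (sort_columns T A R C)"
  let ?m = "O_test_trees_rec hk T A ?Z R C ?f"
  have calls: "HK_calls (O_test_trees hk T A R C) = HK_calls ?m"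
    by (simp add: O_test_trees_def)
  have "real (operations (filter_run (row_has_zero A C) R)) \<le> s * (1 + 2 * n)"
    unfolding s_def
  proof (rule operations_filter_run)
    show "real (operations (row_has_zero A C i)) \<le> 2 * n" for i
      using operations_tests(1)[of A C i] unfolding n_def by linarith
  qed
  moreover have "s * (1 + 2 * n) \<le> 3 * (s * n)"
    using sn by (simp add: algebra_simps mult_le_cancel_left1)
  moreover have "real (operations (sort_columns T A R C)) \<le> n * (1 + s + s * (k * L))"
    using sort_columns_cost[OF assms(3)]
    by (simp add: n_def s_def k_def L_def access_cost_def)
  moreover have "n * (1 + s + s * (k * L)) \<le> 2 * (s * n) + k * (s * n * L)"
    using sn by (simp add: algebra_simps mult_le_cancel_left1)
  moreover have "real (operations ?m) \<le> 5 * (s * n) + (15 + 4 * k) * (n * L) * s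
      + (1 + k) * (q * s) * real (length (live_cols A R C))"
    unfolding s_def n_def L_def k_def q_def
    using assms(3,4,8,9) unfolding calls
    by (intro O_test_trees_rec_operations[OF assms(1,2) _ _ _ sort_columns_stores assms(5-7)])
      (auto simp: Suc_le_eq)
  moreover have "(1 + k) * (q * s) * real (length (live_cols A R C)) \<le> (1 + k) * (q * s) * n"
    using k q sn by (intro mult_left_mono) (auto simp: n_def live_cols_def)
  moreover have "real (operations (O_test_trees hk T A R C)) =
      real (operations (filter_run (row_has_zero A C) R)) + real (operations (sort_columns T A R C))
      + real (operations ?m)"
    by (simp add: O_test_trees_def)
  ultimately have "real (operations (O_test_trees hk T A R C)) \<le> 10 * (s * n) + k * (s * n * L)
      + (15 + 4 * k) * (n * L) * s + (1 + k) * (q * s) * n"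
    by linarith
  also have "\<dots> = (s * n) * (10 + (15 + 5 * k) * L + (1 + k) * q)"
    by (simp add: algebra_simps)
  also have "\<dots> \<le> (s * n) * ((26 + 6 * k) * (q + (L - 1)))"
  proof (rule mult_left_mono)
    have "(25 + 5 * k) * L \<le> (25 + 5 * k) * (q + (L - 1))" using k q by (intro mult_left_mono) auto
    moreover have "(1 + k) * q \<le> (1 + k) * (q + (L - 1))" using k L by (intro mult_left_mono) auto
    moreover have "10 + (15 + 5 * k) * L \<le> (25 + 5 * k) * L" using L by (simp add: algebra_simps)
    ultimately show "10 + (15 + 5 * k) * L + (1 + k) * q \<le> (26 + 6 * k) * (q + (L - 1))"
      by (simp add: algebra_simps)
  qed (use sn in simp)
  finally show ?thesis
    by (simp add: s_def n_def k_def q_def L_def algebra_simps)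
qed

end

section \<open>Correctness and operation bounds\<close>

lemma HK_rank_le_max: "\<forall>e\<in>set (HK_calls m). HK_rank e \<le> max_HK_rank m"
  by (simp add: max_HK_rank_def)

lemma all_C0_empty_HK_calls:
  "all_C0_empty m \<longleftrightarrow>
    (\<forall>R C B R0 C0 Y1 k. HK_Call R C B (R0, C0, Y1) k \<in> set (HK_calls m) \<longrightarrow> C0 = {})"
  by (simp add: all_C0_empty_def HK_calls_def)

theorem theorem56:
  fixes K :: real
  shows
   "(\<forall>hk s n A.
       HK_correct hk \<and> entries_in nat_minf {1..s} {1..n} A \<longrightarrow>
       (let out = result (O_test hk A [1..<Suc s] [1..<Suc n])
        in (O_hat {1..s} {1..n} A = 0 \<longrightarrow>
              (\<exists>Y. out = Some Y \<and> Y \<subseteq> {1..n} \<and> card Y = s \<and>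
                   O_hat {1..s} {1..n} A = O_det {1..s} Y A)) \<and>
           (O_hat {1..s} {1..n} A \<noteq> 0 \<longrightarrow> out = None)))
    \<and>
    (\<exists>c. \<forall>hk s n A.
       HK_correct hk \<and> HK_complexity K hk \<and>
       s \<ge> 1 \<and> n \<ge> 1 \<and> entries_in nat_minf {1..s} {1..n} A \<longrightarrow>
       (let m = O_test hk A [1..<Suc s] [1..<Suc n]; d = max_HK_rank m; p = main_calls m
        in real (operations m) \<le> c * (sqrt (real (max 1 d)) * real p * real s * real n)))
    \<and>
    (\<exists>c. \<forall>hk (T :: 't tree_sub) s n A.
       HK_correct hk \<and> HK_complexity K hk \<and> balanced_trees K T \<and>
       s \<ge> 1 \<and> n \<ge> 1 \<and> entries_in nat_minf {1..s} {1..n} A \<longrightarrow>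
       (let m = O_test hk A [1..<Suc s] [1..<Suc n]; d = max_HK_rank m;
            m' = O_test_trees hk T A [1..<Suc s] [1..<Suc n]
        in result m' = result m \<and> HK_calls m' = HK_calls m \<and>
           (all_C0_empty m \<longrightarrow>
              real (operations m') \<le> c * ((sqrt (real (max 1 d)) + ln (real s)) * real s * real n))))"
proof (intro conjI allI impI)
  fix hk s n A
  assume asm: "HK_correct hk \<and> entries_in nat_minf {1..s} {1..n} A"
  let ?R = "[1..<Suc s]" and ?C = "[1..<Suc n]"
  have sets: "set ?R = {1..s}" "set ?C = {1..n}" by auto
  have det: "O_det {1..s} Y A = 0 \<longleftrightarrow> vanishing_det {1..s} Y A" if "Y \<subseteq> {1..n}" "card Y = s" for Y
    using that asm by (intro O_det_eq_0_iff) (auto simp: entries_in_def intro: finite_subset)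
  have hat: "O_hat {1..s} {1..n} A = 0 \<longleftrightarrow> (\<exists>Y\<subseteq>{1..n}. card Y = s \<and> O_det {1..s} Y A = 0)"
    using O_hat_eq_0_iff[of "{1..s}" "{1..n}" A] asm by simp
  have hat': "O_hat {1..s} {1..n} A = 0 \<longleftrightarrow> (\<exists>Y\<subseteq>{1..n}. vanishing_det {1..s} Y A)"
    unfolding hat using det vanishing_det_card[of "{1..s}" _ A] by (metis card_atLeastAtMost diff_Suc_1)
  have out: "case fst (O_test hk A ?R ?C) of
      None \<Rightarrow> \<not> (\<exists>Y\<subseteq>{1..n}. vanishing_det {1..s} Y A)
    | Some Y \<Rightarrow> Y \<subseteq> {1..n} \<and> vanishing_det {1..s} Y A"
    using O_test_result[of hk ?R ?C A] asm unfolding sets by simp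
  show "let out = result (O_test hk A ?R ?C)
        in (O_hat {1..s} {1..n} A = 0 \<longrightarrow>
              (\<exists>Y. out = Some Y \<and> Y \<subseteq> {1..n} \<and> card Y = s \<and>
                   O_hat {1..s} {1..n} A = O_det {1..s} Y A)) \<and>
           (O_hat {1..s} {1..n} A \<noteq> 0 \<longrightarrow> out = None)"
  proof (cases "fst (O_test hk A ?R ?C)")
    case None
    then show ?thesis using out hat' by (simp add: result_def)
  next
    case (Some Y)
    with out have Y: "Y \<subseteq> {1..n}" "vanishing_det {1..s} Y A" by auto
    then have "card Y = s" using vanishing_det_card[of "{1..s}" Y A] by simp
    moreover from Y this det have "O_det {1..s} Y A = 0" by blast
    moreover have "O_hat {1..s} {1..n} A = 0" using hat' Y by blast
    ultimately show ?thesis using Some Y by (simp add: result_def)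
  qed
next
  show "\<exists>c. \<forall>hk s n A.
       HK_correct hk \<and> HK_complexity K hk \<and>
       s \<ge> 1 \<and> n \<ge> 1 \<and> entries_in nat_minf {1..s} {1..n} A \<longrightarrow>
       (let m = O_test hk A [1..<Suc s] [1..<Suc n]; d = max_HK_rank m; p = main_calls m
        in real (operations m) \<le> c * (sqrt (real (max 1 d)) * real p * real s * real n))"
  proof (intro exI[of _ "20 + 2 * \<bar>K\<bar>"] allI impI)
    fix hk s n A
    assume asm: "HK_correct hk \<and> HK_complexity K hk \<and>
       s \<ge> 1 \<and> n \<ge> 1 \<and> entries_in nat_minf {1..s} {1..n} A"
    let ?m = "O_test hk A [1..<Suc s] [1..<Suc n]"
    have "real (operations ?m) \<le> real (main_calls ?m) *
        ((20 + 2 * \<bar>K\<bar>) * (sqrt (real (max 1 (max_HK_rank ?m))) * real s * real n))"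
      using asm by (intro O_test_operations HK_rank_le_max) auto
    then show "let m = ?m; d = max_HK_rank m; p = main_calls m
        in real (operations m) \<le> (20 + 2 * \<bar>K\<bar>) * (sqrt (real (max 1 d)) * real p * real s * real n)"
      unfolding Let_def by (simp only: mult_ac)
  qed
next
  show "\<exists>c. \<forall>hk (T :: 't tree_sub) s n A.
       HK_correct hk \<and> HK_complexity K hk \<and> balanced_trees K T \<and>
       s \<ge> 1 \<and> n \<ge> 1 \<and> entries_in nat_minf {1..s} {1..n} A \<longrightarrow>
       (let m = O_test hk A [1..<Suc s] [1..<Suc n]; d = max_HK_rank m;
            m' = O_test_trees hk T A [1..<Suc s] [1..<Suc n]
        in result m' = result m \<and> HK_calls m' = HK_calls m \<and>
           (all_C0_empty m \<longrightarrow>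
              real (operations m') \<le> c * ((sqrt (real (max 1 d)) + ln (real s)) * real s * real n)))"
  proof (intro exI[of _ "26 + 6 * \<bar>K\<bar>"] allI impI)
    fix hk s n A and T :: "'t tree_sub"
    assume asm: "HK_correct hk \<and> HK_complexity K hk \<and> balanced_trees K T \<and>
       s \<ge> 1 \<and> n \<ge> 1 \<and> entries_in nat_minf {1..s} {1..n} A"
    let ?R = "[1..<Suc s]" and ?C = "[1..<Suc n]"
    let ?m = "O_test hk A ?R ?C" and ?m' = "O_test_trees hk T A ?R ?C"
    obtain rep where "tree_storage K T rep" using asm balanced_trees_storage by blast
    then interpret tree_storage K T rep .
    have sets: "set ?R = {1..s}" "set ?C = {1..n}" by auto
    have ne: "?R \<noteq> []" "?C \<noteq> []" using asm by auto
    have entries: "entries_in nat_minf (set ?R) (set ?C) A" using asm unfolding sets by blast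
    have agree: "fst ?m' = fst ?m" "HK_calls ?m' = HK_calls ?m"
      using O_test_trees_agrees[OF entries] by auto
    have cost: "real (operations ?m') \<le> (26 + 6 * \<bar>K\<bar>) *
        ((sqrt (real (max 1 (max_HK_rank ?m))) + ln (real s)) * real s * real n)"
      if "all_C0_empty ?m"
      using O_test_trees_operations[OF _ _ ne entries, of hk "max_HK_rank ?m"] asm that
        HK_rank_le_max[of ?m]
      unfolding agree(2) all_C0_empty_HK_calls by simp
    show "let m = ?m; d = max_HK_rank m; m' = ?m'
        in result m' = result m \<and> HK_calls m' = HK_calls m \<and>
           (all_C0_empty m \<longrightarrow> real (operations m') \<le>
              (26 + 6 * \<bar>K\<bar>) * ((sqrt (real (max 1 d)) + ln (real s)) * real s * real n))"
      unfolding Let_def result_def using agree cost by blast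
  qed
qed

end
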